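(* Let $1<\alpha<\beta$ be real, $I_1=[0,1]$, $I_2=[\alpha,\beta]$, and let $L=\frac{1}{i2\pi}\frac{d}{dx}$ be the minimal momentum operator on $L^2(I_1\cup I_2)$ (zero boundary conditions at the four endpoints). Let $\mathscr{C}(L)$ be the set of unitary maps from the deficiency space $\mathscr{D}_+$ of $L$ onto the deficiency space $\mathscr{D}_-$, and let $\mathscr{C}_b$ be the set of isometric linear maps $B:\mathscr{B}_L\to\mathscr{B}_R$ between the spaces of left and right boundary values, i.e. a copy of the group of all unitary $2\times 2$ matrices. Then there is a natural isomorphism (bijective correspondence) $\mathscr{C}_b\cong\mathscr{C}(L)$.
   Context: The domain $\mathscr{D}_0$ of $L$ consists of the absolutely continuous functions $f$ on $I_1\cup I_2$ with $f'\in L^2(I_1\cup I_2)$ and $f(0)=f(1)=f(\alpha)=f(\beta)=0$. The adjoint $L^*=P$ is the maximal momentum operator $\frac{1}{i2\pi}\frac{d}{dx}$, whose domain $\mathscr{D}(P)$ consists of the absolutely continuous functions $f$ on $I_1\cup I_2$ with $f'\in L^2(I_1\cup I_2)$. The deficiency spaces are $\mathscr{D}_\pm=\{\psi\in\mathrm{dom}(L^* ) : L^*\psi=\pm i\psi\}$, and $\mathscr{C}(L)=\{U:\mathscr{D}_+\to\mathscr{D}_- : U^*U=P_{\mathscr{D}_+},\ UU^*=P_{\mathscr{D}_-}\}$, where $P_{\mathscr{D}_\pm}$ are the orthogonal projections onto $\mathscr{D}_\pm$. The boundary-value spaces are the two copies of the Hilbert space $\mathbb{C}^2$ given by $\mathscr{B}_L=\{(f(0),f(\alpha))^T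 : f\in\mathscr{D}(P)\}$ and $\mathscr{B}_R=\{(f(1),f(\beta))^T : f\in\mathscr{D}(P)\}$. *)

theory Defs
  imports "HOL-Analysis.Analysis"
begin

section \<open>The Hilbert space of square-integrable functions on a subset of the line\<close>

text \<open>Elements are equivalence classes of functions on the whole line; the values off \<open>S\<close> are
  irrelevant. The operations on classes are unions over representatives, as usual for quotients.\<close>

definition sq_integrable :: "real set \<Rightarrow> (real \<Rightarrow> complex) set" where
  "sq_integrable S = {f. f \<in> borel_measurable (lebesgue_on S) \<and>
     integrable (lebesgue_on S) (\<lambda>x. (cmod (f x))\<^sup>2)}"

definition ae_rel :: "real set \<Rightarrow> ((real \<Rightarrow> complex) \<times> (real \<Rightarrow> complex)) set" where
  "ae_rel S = {(f, g). f \<in> sq_integrable S \<and> g \<in> sq_integrable S \<and>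
     (AE x in lebesgue_on S. f x = g x)}"

type_synonym l2_elem = "(real \<Rightarrow> complex) set"

definition L2 :: "real set \<Rightarrow> l2_elem set" where
  "L2 S = sq_integrable S // ae_rel S"

definition l2_class :: "real set \<Rightarrow> (real \<Rightarrow> complex) \<Rightarrow> l2_elem" where
  "l2_class S f = ae_rel S `` {f}"

definition l2_add :: "real set \<Rightarrow> l2_elem \<Rightarrow> l2_elem \<Rightarrow> l2_elem" where
  "l2_add S F G = (\<Union>f\<in>F. \<Union>g\<in>G. l2_class S (\<lambda>x. f x + g x))"

definition l2_scale :: "real set \<Rightarrow> complex \<Rightarrow> l2_elem \<Rightarrow> l2_elem" where
  "l2_scale S c F = (\<Union>f\<in>F. l2_class S (\<lambda>x. c * f x))"

definition l2_inner :: "real set \<Rightarrow> l2_elem \<Rightarrow> l2_elem \<Rightarrow> complex" where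
  "l2_inner S F G = the_elem (\<Union>f\<in>F. \<Union>g\<in>G. {LINT x|lebesgue_on S. f x * cnj (g x)})"

section \<open>Unbounded operators, adjoints and deficiency spaces\<close>

text \<open>An operator is identified with its graph.\<close>

type_synonym l2_op = "(l2_elem \<times> l2_elem) set"

definition op_adjoint :: "real set \<Rightarrow> l2_op \<Rightarrow> l2_op" where
  "op_adjoint S T = {(G, H). G \<in> L2 S \<and> H \<in> L2 S \<and>
     (\<forall>(F, K)\<in>T. l2_inner S K G = l2_inner S F H)}"

definition deficiency_space :: "real set \<Rightarrow> l2_op \<Rightarrow> complex \<Rightarrow> l2_elem set" where
  "deficiency_space S T z = {\<Psi>\<in>L2 S. (\<Psi>, l2_scale S z \<Psi>) \<in> op_adjoint S T}"

abbreviation deficiency_plus :: "real set \<Rightarrow> l2_op \<Rightarrow> l2_elem set" where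
  "deficiency_plus S T \<equiv> deficiency_space S T \<i>"

abbreviation deficiency_minus :: "real set \<Rightarrow> l2_op \<Rightarrow> l2_elem set" where
  "deficiency_minus S T \<equiv> deficiency_space S T (- \<i>)"

text \<open>The maps \<open>U\<close> from the first deficiency space to the second with \<open>U\<^sup>* U\<close> and \<open>U U\<^sup>*\<close> the
  projections onto them. Here \<open>V\<close> is \<open>U\<^sup>*\<close>; as \<open>U\<close> is a map between the deficiency spaces only
  (and not extended by zero to their complements), these projections are identity maps.\<close>

definition deficiency_unitaries :: "real set \<Rightarrow> l2_op \<Rightarrow> (l2_elem \<Rightarrow> l2_elem) set" where
  "deficiency_unitaries S T =
    {U \<in> deficiency_plus S T \<rightarrow>\<^sub>E deficiency_minus S T.
      (\<forall>\<Psi>\<in>deficiency_plus S T. \<forall>\<Phi>\<in>deficiency_plus S T.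
         U (l2_add S \<Psi> \<Phi>) = l2_add S (U \<Psi>) (U \<Phi>)) \<and>
      (\<forall>c. \<forall>\<Psi>\<in>deficiency_plus S T. U (l2_scale S c \<Psi>) = l2_scale S c (U \<Psi>)) \<and>
      (\<exists>V \<in> deficiency_minus S T \<rightarrow>\<^sub>E deficiency_plus S T.
         (\<forall>\<Psi>\<in>deficiency_plus S T. \<forall>\<Phi>\<in>deficiency_minus S T.
            l2_inner S (U \<Psi>) \<Phi> = l2_inner S \<Psi> (V \<Phi>)) \<and>
         (\<forall>\<Psi>\<in>deficiency_plus S T. V (U \<Psi>) = \<Psi>) \<and>
         (\<forall>\<Phi>\<in>deficiency_minus S T. U (V \<Phi>) = \<Phi>))}"

text \<open>Von Neumann's extension of \<open>T\<close> given by \<open>U\<close>: the restriction of \<open>T\<^sup>*\<close> to the sums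
  \<open>F + \<Psi> + U \<Psi>\<close> with \<open>F\<close> in the domain of \<open>T\<close> and \<open>\<Psi>\<close> in the first deficiency space.\<close>

definition von_neumann_extension :: "real set \<Rightarrow> l2_op \<Rightarrow> (l2_elem \<Rightarrow> l2_elem) \<Rightarrow> l2_op" where
  "von_neumann_extension S T U =
    {(l2_add S F (l2_add S \<Psi> (U \<Psi>)),
      l2_add S K (l2_add S (l2_scale S \<i> \<Psi>) (l2_scale S (- \<i>) (U \<Psi>)))) | F K \<Psi>.
      (F, K) \<in> T \<and> \<Psi> \<in> deficiency_plus S T}"

section \<open>Momentum operators\<close>

definition abs_continuous_on :: "real set \<Rightarrow> (real \<Rightarrow> complex) \<Rightarrow> bool" where
  "abs_continuous_on S f \<longleftrightarrow>
    (\<forall>e>0. \<exists>d>0. \<forall>(n::nat) u v.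
       (\<forall>k<n. u k \<le> v k \<and> {u k..v k} \<subseteq> S) \<and>
       disjoint_family_on (\<lambda>k. {u k<..<v k}) {..<n} \<and>
       (\<Sum>k<n. v k - u k) < d \<longrightarrow>
       (\<Sum>k<n. cmod (f (v k) - f (u k))) < e)"

definition ae_derivative :: "real set \<Rightarrow> (real \<Rightarrow> complex) \<Rightarrow> (real \<Rightarrow> complex) \<Rightarrow> bool" where
  "ae_derivative S f g \<longleftrightarrow>
    (AE x in lebesgue_on S. (f has_vector_derivative g x) (at x within S))"

definition momentum_on :: "real set \<Rightarrow> (real \<Rightarrow> complex) set \<Rightarrow> l2_op" where
  "momentum_on S D =
    {(l2_class S f, l2_class S (\<lambda>x. 1 / (\<i> * 2 * of_real pi) * g x)) | f g.
      f \<in> D \<and> g \<in> sq_integrable S \<and> ae_derivative S f g}"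

definition two_intervals :: "real \<Rightarrow> real \<Rightarrow> real set" where
  "two_intervals \<alpha> \<beta> = {0..1} \<union> {\<alpha>..\<beta>}"

definition max_domain :: "real \<Rightarrow> real \<Rightarrow> (real \<Rightarrow> complex) set" where
  "max_domain \<alpha> \<beta> =
    {f. abs_continuous_on (two_intervals \<alpha> \<beta>) f \<and>
      (\<exists>g\<in>sq_integrable (two_intervals \<alpha> \<beta>). ae_derivative (two_intervals \<alpha> \<beta>) f g)}"

definition min_domain :: "real \<Rightarrow> real \<Rightarrow> (real \<Rightarrow> complex) set" where
  "min_domain \<alpha> \<beta> = {f \<in> max_domain \<alpha> \<beta>. f 0 = 0 \<and> f 1 = 0 \<and> f \<alpha> = 0 \<and> f \<beta> = 0}"

definition min_momentum :: "real \<Rightarrow> real \<Rightarrow> l2_op" where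
  "min_momentum \<alpha> \<beta> = momentum_on (two_intervals \<alpha> \<beta>) (min_domain \<alpha> \<beta>)"

section \<open>Boundary values\<close>

definition left_values :: "real \<Rightarrow> (real \<Rightarrow> complex) \<Rightarrow> complex ^ 2" where
  "left_values \<alpha> f = vector [f 0, f \<alpha>]"

definition right_values :: "real \<Rightarrow> (real \<Rightarrow> complex) \<Rightarrow> complex ^ 2" where
  "right_values \<beta> f = vector [f 1, f \<beta>]"

definition left_space :: "real \<Rightarrow> real \<Rightarrow> (complex ^ 2) set" where
  "left_space \<alpha> \<beta> = left_values \<alpha> ` max_domain \<alpha> \<beta>"

definition right_space :: "real \<Rightarrow> real \<Rightarrow> (complex ^ 2) set" where
  "right_space \<alpha> \<beta> = right_values \<beta> ` max_domain \<alpha> \<beta>"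

definition boundary_isometries :: "real \<Rightarrow> real \<Rightarrow> (complex ^ 2 \<Rightarrow> complex ^ 2) set" where
  "boundary_isometries \<alpha> \<beta> =
    {B \<in> left_space \<alpha> \<beta> \<rightarrow>\<^sub>E right_space \<alpha> \<beta>.
      (\<forall>u\<in>left_space \<alpha> \<beta>. \<forall>v\<in>left_space \<alpha> \<beta>. B (u + v) = B u + B v) \<and>
      (\<forall>c. \<forall>u\<in>left_space \<alpha> \<beta>. B (c *s u) = c *s B u) \<and>
      (\<forall>u\<in>left_space \<alpha> \<beta>. norm (B u) = norm u)}"

definition boundary_extension ::
    "real \<Rightarrow> real \<Rightarrow> (complex ^ 2 \<Rightarrow> complex ^ 2) \<Rightarrow> l2_op" where
  "boundary_extension \<alpha> \<beta> B = momentum_on (two_intervals \<alpha> \<beta>)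
     {f \<in> max_domain \<alpha> \<beta>. B (left_values \<alpha> f) = right_values \<beta> f}"

definition conj_transpose :: "complex ^ 'n ^ 'm \<Rightarrow> complex ^ 'm ^ 'n" where
  "conj_transpose A = (\<chi> i j. cnj (A $ j $ i))"

definition unitary_matrix :: "complex ^ 'n ^ 'n \<Rightarrow> bool" where
  "unitary_matrix A \<longleftrightarrow> conj_transpose A ** A = mat 1 \<and> A ** conj_transpose A = mat 1"

end

theory Submission
  imports Defs
begin

text \<open>Both deficiency spaces are explicit. A class \<open>\<psi>\<close> solves \<open>L\<^sup>* \<psi> = \<plusminus>\<i> \<psi>\<close> exactly when it is a
  multiple of \<open>exp (\<minusplus>2 \<pi> x)\<close> on each of the two intervals (\<open>deficiency_space_eq\<close>). Normalizing these
  exponentials in \<open>L\<^sup>2\<close> identifies the deficiency spaces isometrically with \<open>\<complex>\<^sup>2\<close>, and unitary maps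
  between them with unitary matrices (\<open>bij_betw_map_of_matrix\<close>).

  Centring the exponentials at the midpoint of each interval makes the picture symmetric: for
  \<open>c, d \<in> \<complex>\<^sup>2\<close> the function \<open>modes 1 c + modes (-1) d\<close> has left boundary values \<open>P c + Q d\<close> and right
  boundary values \<open>Q c + P d\<close> with real diagonal \<open>P\<close>, \<open>Q\<close> satisfying \<open>P\<^sup>2 - Q\<^sup>2 = 4 \<pi>\<close>. So
  \<open>(c, d) \<mapsto> (left, right)\<close> is a linear bijection with
  \<open>\<bar>left\<bar>\<^sup>2 - \<bar>right\<bar>\<^sup>2 = 4 \<pi> (\<bar>c\<bar>\<^sup>2 - \<bar>d\<bar>\<^sup>2)\<close>, which is Green's identity for the maximal operator.
  Graphs of unitary maps are the maximal null spaces of such forms, hence the bijection carries the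
  graph of a unitary \<open>d = T c\<close> to the graph of a unitary \<open>right = A left\<close> and conversely
  (\<open>unitary_pullback_bij\<close>). This correspondence between \<open>A\<close> and \<open>T\<close> is natural: a function in the
  maximal domain differs from a unique \<open>modes 1 c + modes (-1) d\<close> by a function vanishing at the four
  endpoints, so the boundary condition given by \<open>A\<close> cuts out von Neumann's extension given by \<open>T\<close>
  (\<open>von_neumann_extension_eq_boundary_extension\<close>).

  The analytic input is the fundamental theorem of calculus for absolutely continuous functions
  (\<open>abs_continuous_on_has_integral\<close>), which shows that the exponentials lie in the deficiency spaces,
  and a Henstock argument (\<open>AE_zero_if_initial_integrals_zero\<close>), which shows that nothing else does.\<close>

section \<open>Absolutely continuous functions and the fundamental theorem of calculus\<close>

lemma abs_continuous_on_subset: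
  assumes "abs_continuous_on S f" and "T \<subseteq> S"
  shows "abs_continuous_on T f"
  unfolding abs_continuous_on_def
proof (intro allI impI)
  fix e :: real assume "e > 0"
  with assms(1) obtain d where "d > 0" and d: "\<And>n u v. (\<forall>k<n. u k \<le> v k \<and> {u k..v k} \<subseteq> S) \<and>
       disjoint_family_on (\<lambda>k. {u k<..<v k}) {..<(n::nat)} \<and> (\<Sum>k<n. v k - u k) < d
        \<Longrightarrow> (\<Sum>k<n. cmod (f (v k) - f (u k))) < e"
    unfolding abs_continuous_on_def by blast
  show "\<exists>d>0. \<forall>(n::nat) u v. (\<forall>k<n. u k \<le> v k \<and> {u k..v k} \<subseteq> T) \<and>
       disjoint_family_on (\<lambda>k. {u k<..<v k}) {..<n} \<and> (\<Sum>k<n. v k - u k) < d \<longrightarrow>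
       (\<Sum>k<n. cmod (f (v k) - f (u k))) < e"
    using \<open>T \<subseteq> S\<close> by (intro exI[of _ d] conjI \<open>d > 0\<close> allI impI d) (meson order_trans | blast)+
qed

text \<open>Tagged divisions are indexed by pairs of a tag and an interval, so arbitrary finite index sets
  are more convenient than initial segments of the naturals.\<close>

lemma abs_continuous_on_finite_family:
  assumes "abs_continuous_on S f" and "e > 0"
  shows "\<exists>d>0. \<forall>(I :: 'i set) u v. finite I \<and> (\<forall>i\<in>I. u i \<le> v i \<and> {u i..v i} \<subseteq> S) \<and>
    disjoint_family_on (\<lambda>i. {u i<..<v i}) I \<and> (\<Sum>i\<in>I. v i - u i) < d
    \<longrightarrow> (\<Sum>i\<in>I. cmod (f (v i) - f (u i))) < e"
proof -
  from assms obtain d where "d > 0" and d: "\<And>n u v. (\<forall>k<n. u k \<le> v k \<and> {u k..v k} \<subseteq> S) \<and>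
       disjoint_family_on (\<lambda>k. {u k<..<v k}) {..<(n::nat)} \<and> (\<Sum>k<n. v k - u k) < d
        \<Longrightarrow> (\<Sum>k<n. cmod (f (v k) - f (u k))) < e"
    unfolding abs_continuous_on_def by blast
  have "(\<Sum>i\<in>I. cmod (f (v i) - f (u i))) < e"
    if I: "finite I" and uv: "\<forall>i\<in>I. u i \<le> v i \<and> {u i..v i} \<subseteq> S"
      and disj: "disjoint_family_on (\<lambda>i. {u i<..<v i}) I" and small: "(\<Sum>i\<in>I. v i - u i) < d"
    for I :: "'i set" and u v
  proof -
    obtain h where h: "bij_betw h {..<card I} I"
      using ex_bij_betw_nat_finite[OF I] by (auto simp: atLeast0LessThan)
    have hI: "h k \<in> I" if "k < card I" for k
      using h that by (auto simp: bij_betw_def)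
    have "disjoint_family_on (\<lambda>k. {u (h k)<..<v (h k)}) {..<card I}"
      using disj h by (simp add: disjoint_family_on_def bij_betw_def inj_on_def) blast
    moreover have "(\<Sum>k<card I. v (h k) - u (h k)) < d"
      using small sum.reindex_bij_betw[OF h, of "\<lambda>i. v i - u i"] by simp
    ultimately have "(\<Sum>k<card I. cmod (f (v (h k)) - f (u (h k)))) < e"
      using d[of "card I" "\<lambda>k. u (h k)" "\<lambda>k. v (h k)"] uv hI by blast
    then show ?thesis
      using sum.reindex_bij_betw[OF h, of "\<lambda>i. cmod (f (v i) - f (u i))"] by simp
  qed
  with \<open>d > 0\<close> show ?thesis
    by blast
qed

text \<open>All closure properties below (sums, products, Lipschitz functions, piecewise definitions) are
  instances of this comparison of increments. Increments only matter over intervals inside the set.\<close>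

lemma abs_continuous_on_dominated:
  assumes f: "abs_continuous_on S f" and h: "abs_continuous_on S h" and C: "C \<ge> 0"
    and le: "\<And>u v. u \<le> v \<Longrightarrow> {u..v} \<subseteq> S \<Longrightarrow>
      cmod (g v - g u) \<le> C * (cmod (f v - f u) + cmod (h v - h u))"
  shows "abs_continuous_on S g"
  unfolding abs_continuous_on_def
proof (intro allI impI)
  fix e :: real assume "e > 0"
  define e' where "e' = e / (2 * (C + 1))"
  have "e' > 0"
    using \<open>e > 0\<close> C by (simp add: e'_def)
  obtain d1 where d1: "d1 > 0" "\<And>n u v. (\<forall>k<n. u k \<le> v k \<and> {u k..v k} \<subseteq> S) \<and>
       disjoint_family_on (\<lambda>k. {u k<..<v k}) {..<(n::nat)} \<and> (\<Sum>k<n. v k - u k) < d1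
        \<Longrightarrow> (\<Sum>k<n. cmod (f (v k) - f (u k))) < e'"
    using f \<open>e' > 0\<close> unfolding abs_continuous_on_def by blast
  obtain d2 where d2: "d2 > 0" "\<And>n u v. (\<forall>k<n. u k \<le> v k \<and> {u k..v k} \<subseteq> S) \<and>
       disjoint_family_on (\<lambda>k. {u k<..<v k}) {..<(n::nat)} \<and> (\<Sum>k<n. v k - u k) < d2
        \<Longrightarrow> (\<Sum>k<n. cmod (h (v k) - h (u k))) < e'"
    using h \<open>e' > 0\<close> unfolding abs_continuous_on_def by blast
  show "\<exists>d>0. \<forall>(n::nat) u v. (\<forall>k<n. u k \<le> v k \<and> {u k..v k} \<subseteq> S) \<and>
       disjoint_family_on (\<lambda>k. {u k<..<v k}) {..<n} \<and> (\<Sum>k<n. v k - u k) < d \<longrightarrow>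
       (\<Sum>k<n. cmod (g (v k) - g (u k))) < e"
  proof (intro exI[of _ "min d1 d2"] conjI allI impI)
    show "min d1 d2 > 0" using d1 d2 by simp
    fix n :: nat and u v :: "nat \<Rightarrow> real"
    assume *: "(\<forall>k<n. u k \<le> v k \<and> {u k..v k} \<subseteq> S) \<and>
       disjoint_family_on (\<lambda>k. {u k<..<v k}) {..<n} \<and> (\<Sum>k<n. v k - u k) < min d1 d2"
    let ?F = "\<Sum>k<n. cmod (f (v k) - f (u k))" and ?H = "\<Sum>k<n. cmod (h (v k) - h (u k))"
    have F: "?F < e'" and H: "?H < e'"
      using d1(2)[of n u v] d2(2)[of n u v] * by auto
    have "(\<Sum>k<n. cmod (g (v k) - g (u k)))
        \<le> (\<Sum>k<n. C * (cmod (f (v k) - f (u k)) + cmod (h (v k) - h (u k))))"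
      using * le by (intro sum_mono) simp
    also have "\<dots> = C * (?F + ?H)"
      by (simp only: sum_distrib_left[symmetric] sum.distrib)
    also have "\<dots> \<le> C * (2 * e')"
      using F H C by (intro mult_left_mono) auto
    also have "\<dots> < (C + 1) * (2 * e')"
      using \<open>e' > 0\<close> by simp
    also have "\<dots> = e"
      using C by (simp add: e'_def field_simps)
    finally show "(\<Sum>k<n. cmod (g (v k) - g (u k))) < e" .
  qed
qed

lemma abs_continuous_on_add:
  assumes "abs_continuous_on S f" and "abs_continuous_on S h"
  shows "abs_continuous_on S (\<lambda>x. f x + h x)"
proof (rule abs_continuous_on_dominated[OF assms, of 1])
  show "cmod (f v + h v - (f u + h u)) \<le> 1 * (cmod (f v - f u) + cmod (h v - h u))" for u v
    using norm_triangle_ineq[of "f v - f u" "h v - h u"] by (simp add: algebra_simps)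
qed simp

lemma abs_continuous_on_lipschitz:
  assumes "\<And>u v. u \<le> v \<Longrightarrow> {u..v} \<subseteq> S \<Longrightarrow> cmod (g v - g u) \<le> C * (v - u)"
  shows "abs_continuous_on S g"
proof -
  have id: "abs_continuous_on S complex_of_real"
    unfolding abs_continuous_on_def
  proof (intro allI impI exI conjI)
    fix e :: real and n :: nat and u v :: "nat \<Rightarrow> real"
    assume *: "(\<forall>k<n. u k \<le> v k \<and> {u k..v k} \<subseteq> S) \<and>
       disjoint_family_on (\<lambda>k. {u k<..<v k}) {..<n} \<and> (\<Sum>k<n. v k - u k) < e"
    have "(\<Sum>k<n. cmod (complex_of_real (v k) - complex_of_real (u k))) = (\<Sum>k<n. v k - u k)"
      using * by (intro sum.cong) (simp_all flip: of_real_diff)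
    with * show "(\<Sum>k<n. cmod (complex_of_real (v k) - complex_of_real (u k))) < e"
      by simp
  qed
  show ?thesis
  proof (rule abs_continuous_on_dominated[OF id id, of "\<bar>C\<bar>"])
    fix u v :: real assume uv: "u \<le> v" "{u..v} \<subseteq> S"
    have "cmod (g v - g u) \<le> \<bar>C\<bar> * (v - u)"
      using assms[OF uv] mult_right_mono[of C "\<bar>C\<bar>" "v - u"] uv by linarith
    also have "\<dots> \<le> \<bar>C\<bar> * (cmod (of_real v - of_real u) + cmod (of_real v - of_real u))"
      using uv by (intro mult_left_mono) (simp_all flip: of_real_diff)
    finally show "cmod (g v - g u)
        \<le> \<bar>C\<bar> * (cmod (of_real v - of_real u) + cmod (of_real v - of_real u))" .
  qed simp
qed

lemma abs_continuous_on_mult: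
  assumes f: "abs_continuous_on S f" and h: "abs_continuous_on S h"
    and bf: "bounded (f ` S)" and bh: "bounded (h ` S)"
  shows "abs_continuous_on S (\<lambda>x. f x * h x)"
proof -
  obtain A where A: "\<And>x. x \<in> S \<Longrightarrow> cmod (f x) \<le> A"
    using bf by (auto simp: bounded_iff)
  obtain B where B: "\<And>x. x \<in> S \<Longrightarrow> cmod (h x) \<le> B"
    using bh by (auto simp: bounded_iff)
  show ?thesis
  proof (rule abs_continuous_on_dominated[OF f h, of "\<bar>A\<bar> + \<bar>B\<bar>"])
    fix u v :: real assume "u \<le> v" and "{u..v} \<subseteq> S"
    then have S: "u \<in> S" "v \<in> S" by auto
    have "cmod (f v * h v - f u * h u) = cmod (f v * (h v - h u) + (f v - f u) * h u)"
      by (simp add: algebra_simps)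
    also have "\<dots> \<le> cmod (f v) * cmod (h v - h u) + cmod (f v - f u) * cmod (h u)"
      using norm_triangle_ineq by (metis norm_mult)
    also have "\<dots> \<le> (\<bar>A\<bar> + \<bar>B\<bar>) * cmod (h v - h u) + cmod (f v - f u) * (\<bar>A\<bar> + \<bar>B\<bar>)"
      using A[OF S(2)] B[OF S(1)] by (intro add_mono mult_right_mono mult_left_mono) auto
    finally show "cmod (f v * h v - f u * h u)
        \<le> (\<bar>A\<bar> + \<bar>B\<bar>) * (cmod (f v - f u) + cmod (h v - h u))"
      by (simp add: algebra_simps)
  qed simp
qed

lemma abs_continuous_on_imp_continuous_on:
  assumes "abs_continuous_on {a..b} f"
  shows "continuous_on {a..b} f"
  unfolding continuous_on_iff
proof (intro ballI allI impI)
  fix x e :: real assume x: "x \<in> {a..b}" and "e > 0"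
  obtain d where "d > 0" and d: "\<And>n u v. (\<forall>k<n. u k \<le> v k \<and> {u k..v k} \<subseteq> {a..b}) \<and>
       disjoint_family_on (\<lambda>k. {u k<..<v k}) {..<(n::nat)} \<and> (\<Sum>k<n. v k - u k) < d
        \<Longrightarrow> (\<Sum>k<n. cmod (f (v k) - f (u k))) < e"
    using assms \<open>e > 0\<close> unfolding abs_continuous_on_def by blast
  have small: "cmod (f v - f u) < e" if "u \<le> v" "u \<in> {a..b}" "v \<in> {a..b}" "v - u < d" for u v
    using d[of 1 "\<lambda>_. u" "\<lambda>_. v"] that by (simp add: disjoint_family_on_def)
  show "\<exists>d>0. \<forall>x'\<in>{a..b}. dist x' x < d \<longrightarrow> dist (f x') (f x) < e"
  proof (intro exI[of _ d] conjI \<open>d > 0\<close> ballI impI)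
    fix y assume "y \<in> {a..b}" and "dist y x < d"
    then show "dist (f y) (f x) < e"
      using small[of x y] small[of y x] x
      by (cases "x \<le> y") (auto simp: dist_norm norm_minus_commute)
  qed
qed

text \<open>Lebesgue's fundamental theorem of calculus. The Henstock-Kurzweil integral gives it without
  any covering theorem: outside the exceptional null set the gauge is chosen by differentiability,
  as in the classical case; on the null set the gauge keeps the intervals inside an open set of
  tiny measure, where absolute continuity bounds the total increment.\<close>

theorem abs_continuous_on_has_integral:
  fixes f :: "real \<Rightarrow> complex"
  assumes ac: "abs_continuous_on {a..b} f" and "a \<le> b"
    and ae: "AE x in lebesgue_on {a..b}. (f has_vector_derivative g x) (at x within {a..b})"
  shows "(g has_integral (f b - f a)) {a..b}"
proof -
  define N where "N = {x \<in> {a..b}. \<not> (f has_vector_derivative g x) (at x within {a..b})}"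
  have "AE x in lebesgue. x \<in> {a..b} \<longrightarrow> (f has_vector_derivative g x) (at x within {a..b})"
    using ae by (subst (asm) AE_restrict_space_iff) auto
  then obtain N' where "N' \<in> null_sets lebesgue"
    and "{x. \<not> (x \<in> {a..b} \<longrightarrow> (f has_vector_derivative g x) (at x within {a..b}))} \<subseteq> N'"
    by (auto simp: eventually_ae_filter)
  then have N: "N \<in> null_sets lebesgue"
    by (intro null_sets_completion_subset[of N N']) (auto simp: N_def)
  define g' where "g' x = (if x \<in> N then 0 else g x)" for x
  have "(g' has_integral (f b - f a)) {a..b}"
    unfolding has_integral_real
  proof (intro allI impI)
    fix e :: real assume "e > 0"
    from abs_continuous_on_finite_family[OF ac half_gt_zero[OF \<open>e > 0\<close>]]
    obtain d where "d > 0" and d: "\<forall>(I :: (real \<times> real set) set) u v. finite I \<and>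
        (\<forall>i\<in>I. u i \<le> v i \<and> {u i..v i} \<subseteq> {a..b}) \<and>
        disjoint_family_on (\<lambda>i. {u i<..<v i}) I \<and> (\<Sum>i\<in>I. v i - u i) < d
        \<longrightarrow> (\<Sum>i\<in>I. cmod (f (v i) - f (u i))) < e / 2"
      by (elim exE conjE)
    obtain T where T: "open T" "N \<subseteq> T" "T \<in> lmeasurable" "measure lebesgue T < d"
    proof -
      obtain T where T: "open T" "N \<subseteq> T" "T - N \<in> lmeasurable"
          "emeasure lebesgue (T - N) < ennreal d"
        using sets_lebesgue_outer_open[of N d] N \<open>d > 0\<close> by (auto simp: null_sets_def)
      have "emeasure lebesgue T = emeasure lebesgue (T - N)"
        using emeasure_Diff_null_set[OF N, of T] T(1) by simp
      then have "emeasure lebesgue T < ennreal d"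
        using T(4) by simp
      moreover from this have "T \<in> lmeasurable"
        using T(1) by (intro fmeasurableI) (auto intro: less_trans)
      ultimately have "measure lebesgue T < d"
        using \<open>d > 0\<close> by (simp add: emeasure_eq_measure2 ennreal_less_iff)
      with T \<open>T \<in> lmeasurable\<close> show thesis by (intro that)
    qed
    define e' where "e' = (e / 2) / (b - a + 1)"
    have "e' > 0"
      using \<open>e > 0\<close> \<open>a \<le> b\<close> by (simp add: e'_def)
    have "\<exists>r>0. \<forall>y\<in>{a..b}. \<bar>y - x\<bar> < r \<longrightarrow> cmod (f y - f x - (y - x) *\<^sub>R g x) \<le> e' * \<bar>y - x\<bar>"
      if "x \<in> {a..b} - N" for x
      using that \<open>e' > 0\<close> unfolding N_def has_vector_derivative_def has_derivative_within_alt
      by auto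
    then obtain r where r: "\<And>x. x \<in> {a..b} - N \<Longrightarrow> r x > 0" "\<And>x y. x \<in> {a..b} - N \<Longrightarrow> y \<in> {a..b} \<Longrightarrow>
        \<bar>y - x\<bar> < r x \<Longrightarrow> cmod (f y - f x - (y - x) *\<^sub>R g x) \<le> e' * \<bar>y - x\<bar>"
      by metis
    \<comment> \<open>Tags outside the interval never occur; the last case only makes \<open>\<gamma>\<close> a gauge.\<close>
    define \<gamma> where "\<gamma> x = (if x \<in> N then T else if x \<in> {a..b} then ball x (r x) else UNIV)" for x
    have "gauge \<gamma>"
      using T r by (auto simp: gauge_def \<gamma>_def)
    show "\<exists>\<gamma>. gauge \<gamma> \<and> (\<forall>\<D>. \<D> tagged_division_of {a..b} \<and> \<gamma> fine \<D> \<longrightarrow>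
        norm ((\<Sum>(x, K)\<in>\<D>. measure lborel K *\<^sub>R g' x) - (f b - f a)) < e)"
    proof (intro exI[of _ \<gamma>] conjI allI impI \<open>gauge \<gamma>\<close>)
      fix p assume "p tagged_division_of {a..b} \<and> \<gamma> fine p"
      then have p: "p tagged_division_of {a..b}" and fine: "\<gamma> fine p" by simp_all
      define h where "h = (\<lambda>(x :: real, K). measure lborel K *\<^sub>R g' x - (f (Sup K) - f (Inf K)))"
      define pN where "pN = {(x, K) \<in> p. x \<in> N}"
      have "finite p"
        using p by blast
      then have fin: "finite pN" "finite (p - pN)" and "pN \<subseteq> p"
        by (auto simp: pN_def intro: finite_subset[of _ p])
      have K: "x \<in> {a..b} \<and> x \<in> K \<and> K \<subseteq> {a..b} \<and> K = {Inf K..Sup K} \<and> Inf K \<le> Sup K"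
        if "(x, K) \<in> p" for x K
      proof -
        obtain u v where "K = {u..v}"
          using p \<open>(x, K) \<in> p\<close> by (metis box_real(2) tagged_division_ofD(4))
        then show ?thesis
          using tagged_division_ofD(2,3)[OF p that] by auto
      qed
      have "(\<Sum>(x, K)\<in>p. measure lborel K *\<^sub>R g' x) - (f b - f a) = sum h p"
        unfolding additive_tagged_division_1[OF \<open>a \<le> b\<close> p, of f, symmetric] h_def
        by (simp add: sum_subtractf split_def)
      also have "\<dots> = sum h pN + sum h (p - pN)"
        using \<open>finite p\<close> \<open>pN \<subseteq> p\<close> by (metis add.commute sum.subset_diff)
      finally have split: "(\<Sum>(x, K)\<in>p. measure lborel K *\<^sub>R g' x) - (f b - f a)
        = sum h pN + sum h (p - pN)" .
      have "cmod (sum h pN) < e / 2"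
      proof -
        let ?u = "\<lambda>i. Inf (snd i)" and ?v = "\<lambda>i. Sup (snd i)"
        have disj: "disjoint_family_on (\<lambda>i. {?u i<..<?v i}) pN"
          unfolding disjoint_family_on_def
        proof (intro ballI impI)
          fix i j assume "i \<in> pN" "j \<in> pN" "i \<noteq> j"
          then have ij: "(fst i, snd i) \<in> p" "(fst j, snd j) \<in> p" "(fst i, snd i) \<noteq> (fst j, snd j)"
            using \<open>pN \<subseteq> p\<close> by auto
          have "interior (snd i) \<inter> interior (snd j) = {}"
            using tagged_division_ofD(5)[OF p ij] .
          moreover have "interior (snd i) = {?u i<..<?v i}" "interior (snd j) = {?u j<..<?v j}"
            using K[OF ij(1)] K[OF ij(2)] by (metis interior_atLeastAtMost_real)+
          ultimately show "{?u i<..<?v i} \<inter> {?u j<..<?v j} = {}"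
            by simp
        qed
        have finite_Ioo: "emeasure lborel {u<..<v} \<noteq> \<infinity>" for u v :: real
          by (cases "u \<le> v") auto
        have "(\<Sum>i\<in>pN. ?v i - ?u i) = (\<Sum>i\<in>pN. measure lebesgue {?u i<..<?v i})"
          using K \<open>pN \<subseteq> p\<close> by (intro sum.cong) auto
        also have "\<dots> = measure lebesgue (\<Union>i\<in>pN. {?u i<..<?v i})"
          using disj fin 
          by (subst measure_finite_Union) (auto simp: finite_Ioo[simplified])
        also have "\<dots> \<le> measure lebesgue T"
        proof (rule measure_mono_fmeasurable[OF _ _ T(3)])
          show "(\<Union>i\<in>pN. {?u i<..<?v i}) \<subseteq> T"
          proof safe
            fix x K y assume "(x, K) \<in> pN" and y: "y \<in> {Inf (snd (x, K))<..<Sup (snd (x, K))}"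
            then have "(x, K) \<in> p" "x \<in> N" by (auto simp: pN_def)
            then have "K \<subseteq> T" "y \<in> {Inf K..Sup K}" and "K = {Inf K..Sup K}"
              using fine K y by (fastforce simp: fine_def \<gamma>_def)+
            then show "y \<in> T" by blast
          qed
          show "(\<Union>i\<in>pN. {?u i<..<?v i}) \<in> sets lebesgue"
            by (intro sets_completionI_sets) (simp add: borel_open open_UN)
        qed
        finally have "(\<Sum>i\<in>pN. ?v i - ?u i) < d"
          using T by simp
        then have "(\<Sum>i\<in>pN. cmod (f (?v i) - f (?u i))) < e / 2"
          using disj fin K \<open>pN \<subseteq> p\<close> by (intro d[rule_format] conjI ballI) (force, fastforce, fastforce, auto)
        moreover have "cmod (sum h pN) \<le> (\<Sum>i\<in>pN. cmod (f (?v i) - f (?u i)))"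
          by (intro sum_norm_le) (auto simp: h_def pN_def g'_def norm_minus_commute)
        ultimately show ?thesis by simp
      qed
      moreover have "cmod (sum h (p - pN)) \<le> e / 2"
      proof -
        have "cmod (sum h (p - pN)) \<le> (\<Sum>(x, K)\<in>p - pN. e' * measure lborel K)"
        proof (rule sum_norm_le, clarify)
          fix x K assume xK: "(x, K) \<in> p" "(x, K) \<notin> pN"
          let ?u = "Inf K" and ?v = "Sup K"
          have x: "x \<in> {a..b} - N"
            using xK K by (auto simp: pN_def)
          have uv: "?u \<le> x" "x \<le> ?v" "?u \<in> {a..b}" "?v \<in> {a..b}" "measure lborel K = ?v - ?u"
              "?u \<in> K" "?v \<in> K"
            using K[OF xK(1)] by (metis atLeastAtMost_iff content_real order_refl subsetD)+
          have "K \<subseteq> ball x (r x)"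
            using fineD[OF fine xK(1)] x by (simp add: \<gamma>_def)
          then have "\<bar>?u - x\<bar> < r x" "\<bar>?v - x\<bar> < r x"
            using uv by (auto simp: subset_iff dist_real_def abs_minus_commute)
          then have 1: "cmod (f ?u - f x - (?u - x) *\<^sub>R g x) \<le> e' * (x - ?u)"
            and 2: "cmod (f ?v - f x - (?v - x) *\<^sub>R g x) \<le> e' * (?v - x)"
            using r(2)[OF x uv(3)] r(2)[OF x uv(4)] uv by auto
          have "h (x, K) = (f ?u - f x - (?u - x) *\<^sub>R g x) - (f ?v - f x - (?v - x) *\<^sub>R g x)"
            using x by (simp add: h_def g'_def uv(5) algebra_simps)
          also have "cmod \<dots> \<le> e' * (x - ?u) + e' * (?v - x)"
            using norm_triangle_ineq4 1 2 by (meson add_mono order_trans)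
          also have "\<dots> = e' * measure lborel K"
            by (simp add: uv(5) algebra_simps)
          finally show "cmod (h (x, K)) \<le> e' * measure lborel K" .
        qed
        also have "\<dots> \<le> (\<Sum>(x, K)\<in>p. e' * measure lborel K)"
          using \<open>finite p\<close> \<open>e' > 0\<close> by (intro sum_mono2) auto
        also have "\<dots> = e' * (\<Sum>(x, K)\<in>p. measure lborel K)"
          by (simp add: sum_distrib_left split_def)
        also have "(\<Sum>(x, K)\<in>p. measure lborel K) = b - a"
          using additive_content_tagged_division[of p a b] p \<open>a \<le> b\<close> by (simp add: box_real)
        also have "e' * (b - a) \<le> e' * (b - a + 1)"
          using \<open>e' > 0\<close> by simp
        also have "\<dots> = e / 2"
          using \<open>a \<le> b\<close> nonzero_eq_divide_eq[of "b - a + 1" e' "e / 2"] by (simp add: e'_def)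
        finally show ?thesis .
      qed
      ultimately show "norm ((\<Sum>(x, K)\<in>p. measure lborel K *\<^sub>R g' x) - (f b - f a)) < e"
        unfolding split using norm_triangle_ineq[of "sum h pN" "sum h (p - pN)"] by linarith
    qed
  qed
  then show ?thesis
    using N by (elim has_integral_spike[rotated 2]) (auto simp: negligible_iff_null_sets g'_def)
qed

text \<open>By the Henstock lemma the Riemann sums of \<open>\<bar>f\<bar>\<close> are small when all interval integrals vanish,
  so \<open>\<bar>f\<bar>\<close> itself has integral zero.\<close>

lemma AE_zero_if_initial_integrals_zero:
  fixes f :: "real \<Rightarrow> complex"
  assumes int: "integrable (lebesgue_on {a..b}) f"
    and zero: "\<And>t. t \<in> {a..b} \<Longrightarrow> integral {a..t} f = 0"
  shows "AE x in lebesgue_on {a..b}. f x = 0"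
proof -
  have f: "f integrable_on {a..b}"
    using int by (simp add: integrable_on_lebesgue_on)
  have zero': "integral {u..v} f = 0" if "a \<le> u" "u \<le> v" "v \<le> b" for u v
  proof -
    have "integral {a..u} f + integral {u..v} f = integral {a..v} f"
      using that f by (intro Henstock_Kurzweil_Integration.integral_combine) (auto intro: integrable_subinterval_real)
    then show ?thesis
      using zero[of u] zero[of v] that by simp
  qed
  have "((\<lambda>x. cmod (f x)) has_integral 0) {a..b}"
    unfolding has_integral_real
  proof (intro allI impI)
    fix e :: real assume "e > 0"
    obtain \<gamma> where "gauge \<gamma>" and \<gamma>: "\<And>p. p tagged_partial_division_of {a..b} \<Longrightarrow> \<gamma> fine p \<Longrightarrow>
             (\<Sum>(x, K)\<in>p. norm (measure lborel K *\<^sub>R f x - integral K f)) < e"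
      using Henstock_lemma[of f a b e] f \<open>e > 0\<close> by auto
    show "\<exists>\<gamma>. gauge \<gamma> \<and> (\<forall>\<D>. \<D> tagged_division_of {a..b} \<and> \<gamma> fine \<D> \<longrightarrow>
        norm ((\<Sum>(x, K)\<in>\<D>. measure lborel K *\<^sub>R cmod (f x)) - 0) < e)"
    proof (intro exI[of _ \<gamma>] conjI allI impI \<open>gauge \<gamma>\<close>)
      fix p assume "p tagged_division_of {a..b} \<and> \<gamma> fine p"
      then have p: "p tagged_division_of {a..b}" and "\<gamma> fine p" by simp_all
      have K: "integral K f = 0" if "(x, K) \<in> p" for x K
      proof -
        obtain u v where "K = {u..v}"
          using p \<open>(x, K) \<in> p\<close> by (metis box_real(2) tagged_division_ofD(4))
        then show ?thesis
          using tagged_division_ofD(2,3)[OF p that] by (auto intro!: zero')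
      qed
      have "(\<Sum>(x, K)\<in>p. measure lborel K *\<^sub>R cmod (f x)) = (\<Sum>(x, K)\<in>p. norm (measure lborel K *\<^sub>R f x - integral K f))"
        using K by (intro sum.cong) auto
      moreover have "\<dots> < e"
        using p \<open>\<gamma> fine p\<close> by (intro \<gamma>) (auto simp: tagged_division_of_def)
      moreover have "(\<Sum>(x, K)\<in>p. measure lborel K *\<^sub>R cmod (f x)) \<ge> 0"
        by (intro sum_nonneg) auto
      ultimately show "norm ((\<Sum>(x, K)\<in>p. measure lborel K *\<^sub>R cmod (f x)) - 0) < e" by simp
    qed
  qed
  moreover have "((\<lambda>x. cmod (f x)) has_integral (LINT x|lebesgue_on {a..b}. cmod (f x))) {a..b}"
    using int by (intro has_integral_integral_lebesgue_on) auto
  ultimately have "(LINT x|lebesgue_on {a..b}. cmod (f x)) = 0"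
    by (rule has_integral_unique[symmetric])
  then show ?thesis
    using integral_nonneg_eq_0_iff_AE[of "lebesgue_on {a..b}" "\<lambda>x. cmod (f x)"] int by simp
qed

section \<open>The Hilbert space operations on representatives\<close>

lemma sq_integrable_mult_cnj:
  assumes "f \<in> sq_integrable S" and "g \<in> sq_integrable S"
  shows "integrable (lebesgue_on S) (\<lambda>x. f x * cnj (g x))"
proof (rule Bochner_Integration.integrable_bound)
  show "integrable (lebesgue_on S) (\<lambda>x. (cmod (f x))\<^sup>2 + (cmod (g x))\<^sup>2)"
    using assms by (simp add: sq_integrable_def)
  show "(\<lambda>x. f x * cnj (g x)) \<in> borel_measurable (lebesgue_on S)"
  proof (rule borel_measurable_times)
    show "(\<lambda>x. cnj (g x)) \<in> borel_measurable (lebesgue_on S)"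
      using assms by (intro borel_measurable_continuous_on[where f = cnj])
        (auto simp: sq_integrable_def intro: continuous_intros)
  qed (use assms in \<open>simp add: sq_integrable_def\<close>)
  show "AE x in lebesgue_on S. norm (f x * cnj (g x)) \<le> norm ((cmod (f x))\<^sup>2 + (cmod (g x))\<^sup>2)"
  proof (rule always_eventually, intro allI)
    fix x
    have "cmod (f x) * cmod (g x) \<le> (cmod (f x))\<^sup>2 + (cmod (g x))\<^sup>2"
    proof -
      have "0 \<le> cmod (f x) * cmod (g x)"
        by simp
      then show ?thesis
        using sum_squares_bound[of "cmod (f x)" "cmod (g x)"] by linarith
    qed
    then show "norm (f x * cnj (g x)) \<le> norm ((cmod (f x))\<^sup>2 + (cmod (g x))\<^sup>2)"
      by (simp add: norm_mult)
  qed
qed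

lemma sq_integrable_add:
  assumes "f \<in> sq_integrable S" and "g \<in> sq_integrable S"
  shows "(\<lambda>x. f x + g x) \<in> sq_integrable S"
proof -
  have [measurable]: "f \<in> borel_measurable (lebesgue_on S)" "g \<in> borel_measurable (lebesgue_on S)"
    using assms by (simp_all add: sq_integrable_def)
  have "integrable (lebesgue_on S) (\<lambda>x. (cmod (f x + g x))\<^sup>2)"
  proof (rule Bochner_Integration.integrable_bound)
    show "integrable (lebesgue_on S) (\<lambda>x. 2 * ((cmod (f x))\<^sup>2 + (cmod (g x))\<^sup>2))"
      using assms by (simp add: sq_integrable_def)
    show "AE x in lebesgue_on S.
        norm ((cmod (f x + g x))\<^sup>2) \<le> norm (2 * ((cmod (f x))\<^sup>2 + (cmod (g x))\<^sup>2))"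
    proof (rule always_eventually, intro allI)
      fix x
      have "(cmod (f x + g x))\<^sup>2 \<le> (cmod (f x) + cmod (g x))\<^sup>2"
        by (simp add: norm_triangle_ineq power_mono)
      also have "\<dots> \<le> 2 * ((cmod (f x))\<^sup>2 + (cmod (g x))\<^sup>2)"
        using sum_squares_bound[of "cmod (f x)" "cmod (g x)"] by (simp add: power2_sum)
      finally show "norm ((cmod (f x + g x))\<^sup>2) \<le> norm (2 * ((cmod (f x))\<^sup>2 + (cmod (g x))\<^sup>2))"
        by simp
    qed
  qed measurable
  then show ?thesis by (simp add: sq_integrable_def)
qed

lemma sq_integrable_cmult:
  assumes "f \<in> sq_integrable S"
  shows "(\<lambda>x. c * f x) \<in> sq_integrable S"
  using assms by (auto simp: sq_integrable_def norm_mult power_mult_distrib)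

lemma sq_integrable_bounded:
  assumes "f \<in> borel_measurable (lebesgue_on S)" and "S \<in> lmeasurable"
    and "\<And>x. x \<in> S \<Longrightarrow> cmod (f x) \<le> C"
  shows "f \<in> sq_integrable S"
proof -
  interpret finite_measure "lebesgue_on S"
    by (rule finite_measure_lebesgue_on) fact
  have "integrable (lebesgue_on S) (\<lambda>x. (cmod (f x))\<^sup>2)"
  proof (rule integrable_const_bound[of _ "C\<^sup>2"])
    show "AE x in lebesgue_on S. norm ((cmod (f x))\<^sup>2) \<le> C\<^sup>2"
      using assms(3) by (intro AE_I2) (simp add: power_mono)
  qed (use assms(1) in measurable)
  with assms(1) show ?thesis by (simp add: sq_integrable_def)
qed

lemma sq_integrable_continuous:
  assumes "continuous_on S f" and "compact S"
  shows "f \<in> sq_integrable S"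
proof -
  obtain C where "\<And>x. x \<in> S \<Longrightarrow> cmod (f x) \<le> C"
    using compact_imp_bounded[OF compact_continuous_image[OF assms]] by (auto simp: bounded_iff)
  with assms show ?thesis
    by (intro sq_integrable_bounded continuous_imp_measurable_on_sets_lebesgue)
      (auto simp: lmeasurable_compact fmeasurableD)
qed

lemma ae_rel_equiv: "equiv (sq_integrable S) (ae_rel S)"
proof (rule equivI)
  show "trans (ae_rel S)"
  proof (rule transI)
    fix f g h assume "(f, g) \<in> ae_rel S" "(g, h) \<in> ae_rel S"
    then have "AE x in lebesgue_on S. f x = g x" "AE x in lebesgue_on S. g x = h x"
      by (auto simp: ae_rel_def)
    then have "AE x in lebesgue_on S. f x = h x"
      by eventually_elim simp
    with \<open>(f, g) \<in> ae_rel S\<close> \<open>(g, h) \<in> ae_rel S\<close> show "(f, h) \<in> ae_rel S"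
      by (auto simp: ae_rel_def)
  qed
qed (auto simp: refl_on_def sym_def ae_rel_def elim!: AE_mp)

lemma mem_l2_class_iff:
  "g \<in> l2_class S f \<longleftrightarrow> f \<in> sq_integrable S \<and> g \<in> sq_integrable S \<and> (AE x in lebesgue_on S. f x = g x)"
  by (simp add: l2_class_def ae_rel_def)

lemma l2_class_eq_iff:
  assumes "f \<in> sq_integrable S" and "g \<in> sq_integrable S"
  shows "l2_class S f = l2_class S g \<longleftrightarrow> (AE x in lebesgue_on S. f x = g x)"
  using eq_equiv_class_iff[OF ae_rel_equiv assms] assms by (simp add: l2_class_def ae_rel_def)

lemma L2_iff: "F \<in> L2 S \<longleftrightarrow> (\<exists>f\<in>sq_integrable S. F = l2_class S f)"
  by (auto simp: L2_def quotient_def l2_class_def)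

lemma l2_add_class:
  assumes f: "f \<in> sq_integrable S" and g: "g \<in> sq_integrable S"
  shows "l2_add S (l2_class S f) (l2_class S g) = l2_class S (\<lambda>x. f x + g x)"
proof -
  have "l2_class S (\<lambda>x. f' x + g' x) = l2_class S (\<lambda>x. f x + g x)"
    if "f' \<in> l2_class S f" "g' \<in> l2_class S g" for f' g'
  proof -
    from that have "AE x in lebesgue_on S. f x = f' x" "AE x in lebesgue_on S. g x = g' x"
      by (simp_all add: mem_l2_class_iff)
    then have "AE x in lebesgue_on S. f' x + g' x = f x + g x"
      by eventually_elim simp
    with that show ?thesis
      by (subst l2_class_eq_iff) (auto simp: mem_l2_class_iff sq_integrable_add)
  qed
  moreover have "f \<in> l2_class S f" "g \<in> l2_class S g"
    using f g by (simp_all add: mem_l2_class_iff)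
  ultimately show ?thesis
    unfolding l2_add_def by blast
qed

lemma l2_scale_class:
  assumes f: "f \<in> sq_integrable S"
  shows "l2_scale S c (l2_class S f) = l2_class S (\<lambda>x. c * f x)"
proof -
  have "l2_class S (\<lambda>x. c * f' x) = l2_class S (\<lambda>x. c * f x)" if "f' \<in> l2_class S f" for f'
  proof -
    from that have "AE x in lebesgue_on S. f x = f' x"
      by (simp add: mem_l2_class_iff)
    then have "AE x in lebesgue_on S. c * f' x = c * f x"
      by eventually_elim simp
    with that show ?thesis
      by (subst l2_class_eq_iff) (auto simp: mem_l2_class_iff sq_integrable_cmult)
  qed
  moreover have "f \<in> l2_class S f"
    using f by (simp add: mem_l2_class_iff)
  ultimately show ?thesis
    unfolding l2_scale_def by blast
qed

lemma l2_inner_class: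
  assumes f: "f \<in> sq_integrable S" and g: "g \<in> sq_integrable S"
  shows "l2_inner S (l2_class S f) (l2_class S g) = (LINT x|lebesgue_on S. f x * cnj (g x))"
proof -
  have "(LINT x|lebesgue_on S. f' x * cnj (g' x)) = (LINT x|lebesgue_on S. f x * cnj (g x))"
    if "f' \<in> l2_class S f" "g' \<in> l2_class S g" for f' g'
  proof (rule integral_cong_AE)
    from that have "AE x in lebesgue_on S. f x = f' x" "AE x in lebesgue_on S. g x = g' x"
      by (simp_all add: mem_l2_class_iff)
    then show "AE x in lebesgue_on S. f' x * cnj (g' x) = f x * cnj (g x)"
      by eventually_elim simp
  qed (use that in \<open>auto simp: mem_l2_class_iff intro!: borel_measurable_integrable sq_integrable_mult_cnj\<close>)
  moreover have "f \<in> l2_class S f" "g \<in> l2_class S g"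
    using f g by (simp_all add: mem_l2_class_iff)
  ultimately have "(\<Union>f'\<in>l2_class S f. \<Union>g'\<in>l2_class S g. {LINT x|lebesgue_on S. f' x * cnj (g' x)})
      = {LINT x|lebesgue_on S. f x * cnj (g x)}"
    by blast
  then show ?thesis
    unfolding l2_inner_def by simp
qed

section \<open>Unitary matrices and a linear fractional transformation of them\<close>

definition vec_inner :: "complex ^ 'n \<Rightarrow> complex ^ 'n \<Rightarrow> complex" where
  "vec_inner x y = (\<Sum>j\<in>UNIV. x $ j * cnj (y $ j))"

lemma vec_inner_add_left: "vec_inner (x + y) z = vec_inner x z + vec_inner y z"
  by (simp add: vec_inner_def sum.distrib algebra_simps)

lemma vec_inner_add_right: "vec_inner x (y + z) = vec_inner x y + vec_inner x z"
  by (simp add: vec_inner_def sum.distrib algebra_simps)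

lemma vec_inner_diff_left: "vec_inner (x - y) z = vec_inner x z - vec_inner y z"
  by (simp add: vec_inner_def sum_subtractf algebra_simps)

lemma vec_inner_scale_left: "vec_inner (c *s x) y = c * vec_inner x y"
  by (simp add: vec_inner_def sum_distrib_left mult.assoc)

lemma vec_inner_scale_right: "vec_inner x (c *s y) = cnj c * vec_inner x y"
  by (simp add: vec_inner_def sum_distrib_left mult_ac)

lemma vec_inner_self: "vec_inner x x = complex_of_real ((norm x)\<^sup>2)"
  by (simp add: vec_inner_def norm_vec_def L2_set_def sum_nonneg flip: complex_norm_square)

lemma vec_inner_conj_transpose: "vec_inner (A *v x) y = vec_inner x (conj_transpose A *v y)"
proof -
  have "vec_inner (A *v x) y = (\<Sum>i\<in>UNIV. \<Sum>j\<in>UNIV. A $ i $ j * x $ j * cnj (y $ i))"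
    by (simp add: vec_inner_def matrix_vector_mult_def sum_distrib_right)
  also have "\<dots> = (\<Sum>j\<in>UNIV. \<Sum>i\<in>UNIV. A $ i $ j * x $ j * cnj (y $ i))"
    by (rule sum.swap)
  also have "\<dots> = vec_inner x (conj_transpose A *v y)"
    by (simp add: vec_inner_def matrix_vector_mult_def conj_transpose_def sum_distrib_left mult_ac)
  finally show ?thesis .
qed

lemma vec_inner_eqI:
  assumes "\<And>y. vec_inner x y = vec_inner x' y"
  shows "x = x'"
proof -
  have "vec_inner (x - x') (x - x') = 0"
    using assms by (simp add: vec_inner_diff_left)
  then show ?thesis
    unfolding vec_inner_self by simp
qed

text \<open>Polarization: an isometry preserves the inner product, not only the norm.\<close>

lemma unitary_matrix_iff_norm:
  fixes A :: "complex ^ 'n ^ 'n"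
  shows "unitary_matrix A \<longleftrightarrow> (\<forall>x. norm (A *v x) = norm x)"
proof
  assume "unitary_matrix A"
  show "\<forall>x. norm (A *v x) = norm x"
  proof
    fix x
    have "vec_inner (A *v x) (A *v x) = vec_inner x x"
      using \<open>unitary_matrix A\<close>
      by (simp add: vec_inner_conj_transpose matrix_vector_mul_assoc unitary_matrix_def)
    then have "(norm (A *v x))\<^sup>2 = (norm x)\<^sup>2"
      unfolding vec_inner_self using of_real_eq_iff by blast
    then show "norm (A *v x) = norm x"
      by simp
  qed
next
  assume norm: "\<forall>x. norm (A *v x) = norm x"
  have inner: "vec_inner (A *v x) (A *v y) = vec_inner x y" for x y
  proof -
    define D where "D x y = vec_inner (A *v x) (A *v y) - vec_inner x y" for x y
    have add: "D (x + y) (x + y) = D x x + D x y + D y x + D y y" for x y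
      by (simp add: D_def matrix_vector_right_distrib vec_inner_add_left vec_inner_add_right)
    have 0: "D x x = 0" for x
      using norm by (simp add: D_def vec_inner_self)
    \<comment> \<open>\<open>D\<close> is sesquilinear with vanishing diagonal.\<close>
    have swap: "D x y + D y x = 0" for x y
      using add[of x y] by (simp add: 0)
    have "D (\<i> *s x) y = \<i> * D x y" "D y (\<i> *s x) = - \<i> * D y x"
      by (simp_all add: D_def vector_scalar_commute vec_inner_scale_left vec_inner_scale_right
          algebra_simps)
    then have "\<i> * (D x y - D y x) = 0"
      using swap[of "\<i> *s x" y] by (simp add: algebra_simps)
    with swap[of x y] have "D x y = 0"
      by simp
    then show ?thesis by (simp add: D_def)
  qed
  have "(conj_transpose A ** A) *v x = mat 1 *v x" for x
  proof (rule vec_inner_eqI)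
    fix y
    have "vec_inner y ((conj_transpose A ** A) *v x) = vec_inner y x"
      using inner[of y x] by (simp add: vec_inner_conj_transpose matrix_vector_mul_assoc)
    moreover have "vec_inner u v = cnj (vec_inner v u)" for u v :: "complex ^ 'n"
      by (simp add: vec_inner_def mult.commute)
    ultimately show "vec_inner ((conj_transpose A ** A) *v x) y = vec_inner (mat 1 *v x) y"
      by (metis matrix_vector_mul_lid)
  qed
  then have "conj_transpose A ** A = mat 1"
    by (simp add: matrix_eq)
  then show "unitary_matrix A"
    by (simp add: unitary_matrix_def matrix_left_right_inverse)
qed

lemma matrix_of_additive_homogeneous:
  fixes B :: "complex ^ 'n \<Rightarrow> complex ^ 'm"
  assumes "\<And>u v. B (u + v) = B u + B v" and "\<And>c u. B (c *s u) = c *s B u"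
  shows "matrix B *v x = B x"
  by (rule matrix_works) (use assms in \<open>unfold_locales, auto\<close>)

definition mix :: "('n \<Rightarrow> real) \<Rightarrow> ('n \<Rightarrow> real) \<Rightarrow> complex ^ 'n \<Rightarrow> complex ^ 'n \<Rightarrow> complex ^ 'n" where
  "mix p q c d = (\<chi> j. of_real (p j) * c $ j + of_real (q j) * d $ j)"

lemma mix_nth [simp]: "mix p q c d $ j = of_real (p j) * c $ j + of_real (q j) * d $ j"
  by (simp add: mix_def)

text \<open>Swapping \<open>p\<close> and \<open>q\<close> does not change the cross terms, so they cancel. Hence the map
  \<open>(c, d) \<mapsto> (mix p q c d, mix q p c d)\<close> multiplies the form \<open>\<bar>c\<bar>\<^sup>2 - \<bar>d\<bar>\<^sup>2\<close> by \<open>K\<close>.\<close>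

lemma norm_mix_diff:
  assumes "\<And>j. (p j)\<^sup>2 - (q j)\<^sup>2 = K"
  shows "(norm (mix p q c d))\<^sup>2 - (norm (mix q p c d))\<^sup>2 = K * ((norm c)\<^sup>2 - (norm d)\<^sup>2)"
proof -
  have "(cmod (of_real r * x + of_real s * y))\<^sup>2 - (cmod (of_real s * x + of_real r * y))\<^sup>2
      = (r\<^sup>2 - s\<^sup>2) * ((cmod x)\<^sup>2 - (cmod y)\<^sup>2)" for r s x y
    unfolding cmod_power2 by (simp add: power2_eq_square algebra_simps)
  then have "(cmod (mix p q c d $ j))\<^sup>2 - (cmod (mix q p c d $ j))\<^sup>2
      = K * ((cmod (c $ j))\<^sup>2 - (cmod (d $ j))\<^sup>2)" for j
    using assms[of j] by simp
  then have "(\<Sum>j\<in>UNIV. (cmod (mix p q c d $ j))\<^sup>2 - (cmod (mix q p c d $ j))\<^sup>2)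
      = (\<Sum>j\<in>UNIV. K * ((cmod (c $ j))\<^sup>2 - (cmod (d $ j))\<^sup>2))"
    by (intro sum.cong refl)
  then show ?thesis
    by (simp add: norm_vec_def L2_set_def sum_nonneg sum_subtractf sum_distrib_left del: mix_nth)
      (simp add: sum_subtractf sum_distrib_left right_diff_distrib)
qed

text \<open>The graph of a unitary matrix is a maximal null space of the form \<open>\<bar>x\<bar>\<^sup>2 - \<bar>y\<bar>\<^sup>2\<close>, hence pulls
  back to a maximal null space of \<open>\<bar>c\<bar>\<^sup>2 - \<bar>d\<bar>\<^sup>2\<close>, which is again such a graph. Concretely, the
  equation \<open>Q c + P d = A (P c + Q d)\<close> is solved for \<open>d\<close>; the coefficient \<open>P - A Q\<close> is injective,
  because a null vector \<open>d\<close> gives a pair \<open>(0, d)\<close> in the null space, which forces \<open>\<bar>d\<bar> = 0\<close>.\<close>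

lemma unitary_pullback_exists:
  fixes A :: "complex ^ 'n ^ 'n"
  assumes K: "\<And>j. (p j)\<^sup>2 - (q j)\<^sup>2 = K" "K \<noteq> 0" and A: "unitary_matrix A"
  shows "\<exists>T. unitary_matrix T \<and> (\<forall>c d. mix q p c d = A *v mix p q c d \<longleftrightarrow> d = T *v c)"
proof -
  have iso: "norm c = norm d" if "mix q p c d = A *v mix p q c d" for c d
  proof -
    have "norm (mix q p c d) = norm (mix p q c d)"
      using that A by (simp add: unitary_matrix_iff_norm)
    then show ?thesis
      using norm_mix_diff[of p q K c d] K by simp
  qed
  define P :: "complex ^ 'n ^ 'n" where "P = (\<chi> i j. if i = j then of_real (p i) else 0)"
  define Q :: "complex ^ 'n ^ 'n" where "Q = (\<chi> i j. if i = j then of_real (q i) else 0)"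
  have PQ: "mix p q c d = P *v c + Q *v d" "mix q p c d = Q *v c + P *v d" for c d
    by (simp_all add: vec_eq_iff P_def Q_def matrix_vector_mult_def if_distrib if_distribR
        cong: if_cong)
  define M where "M = P - A ** Q"
  define R where "R = A ** P - Q"
  have rel: "mix q p c d = A *v mix p q c d \<longleftrightarrow> M *v d = R *v c" for c d
    unfolding PQ M_def R_def
    by (auto simp: matrix_vector_right_distrib matrix_vector_mult_diff_rdistrib
        matrix_vector_mul_assoc algebra_simps)
  have "d = 0" if "M *v d = 0" for d
    using rel[of 0 d] iso[of 0 d] that by simp
  then obtain M' where M': "M' ** M = mat 1"
    using matrix_left_invertible_ker by blast
  then have "M ** M' = mat 1"
    by (simp add: matrix_left_right_inverse)
  define T where "T = M' ** R"
  have T: "mix q p c d = A *v mix p q c d \<longleftrightarrow> d = T *v c" for c d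
  proof
    assume "mix q p c d = A *v mix p q c d"
    then have "M' *v (M *v d) = M' *v (R *v c)"
      by (simp add: rel)
    then show "d = T *v c"
      using M' by (simp add: T_def matrix_vector_mul_assoc)
  next
    assume "d = T *v c"
    then have "M *v d = (M ** M') *v (R *v c)"
      by (simp add: T_def matrix_vector_mul_assoc matrix_mul_assoc)
    then show "mix q p c d = A *v mix p q c d"
      using \<open>M ** M' = mat 1\<close> by (simp add: rel)
  qed
  then have "unitary_matrix T"
    using iso by (metis unitary_matrix_iff_norm)
  with T show ?thesis by blast
qed

text \<open>The inverse of a mixing map is again a mixing map, so pulling back along it reverses the
  correspondence between the unitary matrices \<open>A\<close> and \<open>T\<close>.\<close>

lemma mix_inverse:
  assumes K: "\<And>j. (p j)\<^sup>2 - (q j)\<^sup>2 = K" "K \<noteq> 0"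
  defines "p' \<equiv> \<lambda>j. p j / K" and "q' \<equiv> \<lambda>j. - q j / K"
  shows "x = mix p q c d \<and> y = mix q p c d \<longleftrightarrow> c = mix p' q' x y \<and> d = mix q' p' x y"
proof -
  have K': "of_real (p j) * of_real (p j) - of_real (q j) * of_real (q j) = complex_of_real K" for j
    using K(1)[of j] by (simp add: power2_eq_square flip: of_real_mult of_real_diff)
  have "x $ j = of_real (p j) * c $ j + of_real (q j) * d $ j
        \<and> y $ j = of_real (q j) * c $ j + of_real (p j) * d $ j
      \<longleftrightarrow> c $ j = (of_real (p j) * x $ j - of_real (q j) * y $ j) / of_real K
        \<and> d $ j = (of_real (p j) * y $ j - of_real (q j) * x $ j) / of_real K" for j
  proof -
    have "u = a * c' + b * d' \<and> v = b * c' + a * d'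
        \<longleftrightarrow> c' = (a * u - b * v) / k \<and> d' = (a * v - b * u) / k"
      if k: "a * a - b * b = k" "k \<noteq> 0" for a b c' d' u v k :: complex
    proof
      assume "u = a * c' + b * d' \<and> v = b * c' + a * d'"
      then have "c' * k = a * u - b * v" "d' * k = a * v - b * u"
        by (simp_all add: k(1)[symmetric] algebra_simps)
      then show "c' = (a * u - b * v) / k \<and> d' = (a * v - b * u) / k"
        using k(2) by (simp add: eq_divide_eq)
    next
      assume "c' = (a * u - b * v) / k \<and> d' = (a * v - b * u) / k"
      then have "c' * k = a * u - b * v" "d' * k = a * v - b * u"
        using k(2) by (simp_all add: eq_divide_eq)
      then have "(a * c' + b * d') * k = u * k" "(b * c' + a * d') * k = v * k"
        using k(1) by algebra+
      then show "u = a * c' + b * d' \<and> v = b * c' + a * d'"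
        using k(2) by simp
    qed
    then show ?thesis using K'[of j] K(2) by simp
  qed
  then have "x $ j = mix p q c d $ j \<and> y $ j = mix q p c d $ j
      \<longleftrightarrow> c $ j = mix p' q' x y $ j \<and> d $ j = mix q' p' x y $ j" for j
    by (simp add: p'_def q'_def diff_divide_distrib)
  then show ?thesis
    unfolding vec_eq_iff by blast
qed

lemma unitary_pullback_bij:
  fixes p q :: "'n::finite \<Rightarrow> real"
  assumes K: "\<And>j. (p j)\<^sup>2 - (q j)\<^sup>2 = K" "K \<noteq> 0"
  shows "\<exists>\<tau>. bij_betw \<tau> {A :: complex ^ 'n ^ 'n. unitary_matrix A} {A. unitary_matrix A} \<and>
    (\<forall>A c d. unitary_matrix A \<longrightarrow> (mix q p c d = A *v mix p q c d \<longleftrightarrow> d = \<tau> A *v c))"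
proof -
  define p' where "p' j = p j / K" for j
  define q' where "q' j = - q j / K" for j
  have inv: "x = mix p q c d \<and> y = mix q p c d \<longleftrightarrow> c = mix p' q' x y \<and> d = mix q' p' x y" for x y c d
    using mix_inverse[OF K] by (simp add: p'_def[abs_def] q'_def[abs_def])
  have K': "(p' j)\<^sup>2 - (q' j)\<^sup>2 = 1 / K" for j
  proof -
    have "(p' j)\<^sup>2 - (q' j)\<^sup>2 = ((p j)\<^sup>2 - (q j)\<^sup>2) / K\<^sup>2"
      by (simp add: p'_def q'_def power_divide diff_divide_distrib)
    then show ?thesis
      using K by (simp add: power2_eq_square)
  qed
  have "\<forall>A :: complex ^ 'n ^ 'n. \<exists>T. unitary_matrix A \<longrightarrow>
      unitary_matrix T \<and> (\<forall>c d. mix q p c d = A *v mix p q c d \<longleftrightarrow> d = T *v c)"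
  proof
    fix A :: "complex ^ 'n ^ 'n"
    show "\<exists>T. unitary_matrix A \<longrightarrow>
        unitary_matrix T \<and> (\<forall>c d. mix q p c d = A *v mix p q c d \<longleftrightarrow> d = T *v c)"
    proof (cases "unitary_matrix A")
      case True
      from unitary_pullback_exists[OF K True] show ?thesis
        by (simp only: True simp_thms)
    qed simp
  qed
  from choice[OF this] obtain \<tau> where \<tau>_all: "\<forall>A :: complex ^ 'n ^ 'n. unitary_matrix A \<longrightarrow>
      unitary_matrix (\<tau> A) \<and> (\<forall>c d. mix q p c d = A *v mix p q c d \<longleftrightarrow> d = \<tau> A *v c)"
    by (elim exE)
  have \<tau>: "unitary_matrix (\<tau> A)" "mix q p c d = A *v mix p q c d \<longleftrightarrow> d = \<tau> A *v c"
    if "unitary_matrix A" for A :: "complex ^ 'n ^ 'n" and c d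
    using \<tau>_all that by simp_all
  have "bij_betw \<tau> {A :: complex ^ 'n ^ 'n. unitary_matrix A} {A. unitary_matrix A}"
    unfolding bij_betw_def
  proof (intro conjI inj_onI subset_antisym subsetI)
    fix A B :: "complex ^ 'n ^ 'n"
    assume AB: "A \<in> {A. unitary_matrix A}" "B \<in> {A. unitary_matrix A}" "\<tau> A = \<tau> B"
    have "A *v x = B *v x" for x
    proof -
      define c where "c = mix p' q' x (A *v x)"
      define d where "d = mix q' p' x (A *v x)"
      have x: "x = mix p q c d" "A *v x = mix q p c d"
        using inv[of x c d "A *v x"] by (auto simp: c_def d_def)
      then have "mix q p c d = B *v mix p q c d"
        using \<tau>(2)[of A c d] \<tau>(2)[of B c d] AB by simp
      with x show ?thesis by simp
    qed
    then show "A = B" by (simp add: matrix_eq)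
  next
    fix T assume "T \<in> \<tau> ` {A. unitary_matrix A}"
    then show "T \<in> {A. unitary_matrix A}" using \<tau>(1) by auto
  next
    fix T :: "complex ^ 'n ^ 'n" assume "T \<in> {A. unitary_matrix A}"
    then obtain A where A: "unitary_matrix A"
      and eq: "\<And>x y. mix q' p' x y = T *v mix p' q' x y \<longleftrightarrow> y = A *v x"
      using unitary_pullback_exists[of p' q' "1 / K" T, OF K'] K by auto
    have "\<tau> A *v c = T *v c" for c
    proof -
      have "mix q p c (T *v c) = A *v mix p q c (T *v c)"
        using inv[of "mix p q c (T *v c)" c "T *v c" "mix q p c (T *v c)"]
          eq[of "mix p q c (T *v c)" "mix q p c (T *v c)"] by metis
      then show ?thesis using \<tau>(2)[OF A] by simp
    qed
    then have "\<tau> A = T" by (simp add: matrix_eq)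
    with A show "T \<in> \<tau> ` {A. unitary_matrix A}" by blast
  qed
  with \<tau>(2) show ?thesis by blast
qed

section \<open>Two disjoint intervals\<close>

text \<open>The two intervals are indexed by the type \<open>2\<close>, so that boundary values are vectors of
  endpoint values and integrals over the union are sums over the index.\<close>

definition component :: "real \<Rightarrow> 2" where
  "component x = (if x \<le> 1 then 1 else 2)"

locale disjoint_intervals =
  fixes \<alpha> \<beta> :: real
  assumes one_less: "1 < \<alpha>" and less: "\<alpha> < \<beta>"
begin

abbreviation S where "S \<equiv> two_intervals \<alpha> \<beta>"

definition lend :: "2 \<Rightarrow> real" where "lend j = (if j = 1 then 0 else \<alpha>)"
definition rend :: "2 \<Rightarrow> real" where "rend j = (if j = 1 then 1 else \<beta>)"

abbreviation I where "I j \<equiv> {lend j..rend j}"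

lemma lend_less_rend: "lend j < rend j"
  using less by (simp add: lend_def rend_def)

lemma S_eq: "S = I 1 \<union> I 2"
  by (simp add: two_intervals_def lend_def rend_def)

lemma I_subset: "I j \<subseteq> S"
  using exhaust_2[of j] by (auto simp: S_eq)

lemma mem_S_cases:
  assumes "x \<in> S"
  obtains j where "x \<in> I j"
  using assms by (auto simp: S_eq)

lemma component_eq: "x \<in> I j \<Longrightarrow> component x = j"
  using exhaust_2[of j] one_less by (auto simp: component_def lend_def rend_def)

lemma I_disjoint: "I 1 \<inter> I 2 = {}"
  using one_less by (auto simp: lend_def rend_def)

lemma compact_S: "compact S"
  by (simp add: S_eq compact_Un)

lemma lmeasurable_S: "S \<in> lmeasurable"
  by (simp add: compact_S lmeasurable_compact)

lemma sets_S [simp]: "S \<in> sets lebesgue"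
  by (simp add: fmeasurableD lmeasurable_S)

lemma component_constant:
  assumes "u \<le> v" and "{u..v} \<subseteq> S"
  shows "component u = component v"
proof (rule ccontr)
  assume "component u \<noteq> component v"
  moreover have "u \<in> S" "v \<in> S" using assms by auto
  ultimately have "u \<le> 1" "\<alpha> \<le> v"
    using assms(1) one_less
    by (auto simp: component_def two_intervals_def split: if_splits)
  then have "(1 + \<alpha>) / 2 \<in> {u..v}"
    using one_less by (auto simp: field_simps)
  then have "(1 + \<alpha>) / 2 \<in> S" using assms by blast
  then show False
    using one_less by (auto simp: two_intervals_def field_simps)
qed

lemma at_within_S:
  assumes "x \<in> I j"
  shows "at x within S = at x within I j"
proof -
  obtain i where S: "S = I i \<union> I j" and disj: "I i \<inter> I j = {}"
    using exhaust_2[of j] S_eq I_disjoint by (metis Int_commute Un_commute)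
  show ?thesis
  proof (rule at_within_nhd)
    show "x \<in> - I i" using assms disj by blast
    show "S \<inter> - I i - {x} = I j \<inter> - I i - {x}" using S by blast
  qed (simp add: open_Compl)
qed

lemma AE_S_iff: "(AE x in lebesgue_on S. P x) \<longleftrightarrow> (\<forall>j. AE x in lebesgue_on (I j). P x)"
proof -
  have "(AE x in lebesgue_on S. P x) \<longleftrightarrow> (AE x in lebesgue. (x \<in> I 1 \<longrightarrow> P x) \<and> (x \<in> I 2 \<longrightarrow> P x))"
    by (subst AE_restrict_space_iff) (auto simp: S_eq intro!: AE_cong)
  then show ?thesis
    by (simp add: forall_2 AE_restrict_space_iff)
qed

lemma integrable_I:
  fixes F :: "real \<Rightarrow> complex"
  assumes "integrable (lebesgue_on S) F"
  shows "integrable (lebesgue_on (I j)) F"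
proof -
  have "set_integrable lebesgue S F"
    using assms by (simp add: set_integrable_def integrable_restrict_space)
  then have "set_integrable lebesgue (I j) F"
    by (rule set_integrable_subset) (use I_subset in auto)
  then show ?thesis
    by (simp add: set_integrable_def integrable_restrict_space)
qed

lemma integral_S:
  fixes F :: "real \<Rightarrow> complex"
  assumes "integrable (lebesgue_on S) F"
  shows "(LINT x|lebesgue_on S. F x) = (\<Sum>j\<in>UNIV. LINT x|lebesgue_on (I j). F x)"
proof -
  have "set_integrable lebesgue (I j) F" for j
    using integrable_I[OF assms, of j] by (simp add: set_integrable_def integrable_restrict_space)
  then have "(LINT x:I 1 \<union> I 2|lebesgue. F x) = (LINT x:I 1|lebesgue. F x) + (LINT x:I 2|lebesgue. F x)"
    by (intro set_integral_Un I_disjoint)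
  then show ?thesis
    by (simp add: sum_2 S_eq set_lebesgue_integral_def integral_restrict_space)
qed

lemma continuous_on_S:
  fixes f :: "real \<Rightarrow> complex"
  assumes "\<And>j. continuous_on (I j) f"
  shows "continuous_on S f"
  unfolding S_eq by (intro continuous_on_closed_Un assms) auto

lemma abs_continuous_on_S_imp_continuous_on: "abs_continuous_on S f \<Longrightarrow> continuous_on S f"
  using I_subset
  by (intro continuous_on_S abs_continuous_on_imp_continuous_on) (metis abs_continuous_on_subset)

lemma abs_continuous_on_piecewise:
  assumes "\<And>j. abs_continuous_on S (F j)"
  shows "abs_continuous_on S (\<lambda>x. F (component x) x)"
proof (rule abs_continuous_on_dominated[OF assms[of 1] assms[of 2], of 1])
  fix u v assume "u \<le> v" "{u..v} \<subseteq> S"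
  then have "component v = component u" by (simp add: component_constant)
  then show "cmod (F (component v) v - F (component u) u)
      \<le> 1 * (cmod (F 1 v - F 1 u) + cmod (F 2 v - F 2 u))"
    using exhaust_2[of "component u"] by auto
qed simp

lemma abs_continuous_on_S_if_bounded_derivative:
  assumes deriv: "\<And>x. x \<in> S \<Longrightarrow> (f has_vector_derivative f' x) (at x within S)"
    and bound: "bounded (f' ` S)"
  shows "abs_continuous_on S f"
proof -
  obtain C where C: "\<And>x. x \<in> S \<Longrightarrow> cmod (f' x) \<le> C"
    using bound by (auto simp: bounded_iff)
  show ?thesis
  proof (rule abs_continuous_on_lipschitz[of _ _ C])
    fix u v :: real assume uv: "u \<le> v" "{u..v} \<subseteq> S"
    have "cmod (f v - f u) \<le> C * norm (v - u)"
    proof (rule differentiable_bound[of "{u..v}" f "\<lambda>x h. h *\<^sub>R f' x"])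
      fix x assume x: "x \<in> {u..v}"
      then have "(f has_vector_derivative f' x) (at x within {u..v})"
        using uv by (blast intro: has_vector_derivative_within_subset deriv)
      then show "(f has_derivative (\<lambda>h. h *\<^sub>R f' x)) (at x within {u..v})"
        by (simp add: has_vector_derivative_def)
      show "onorm (\<lambda>h. h *\<^sub>R f' x) \<le> C"
        using onorm_scaleR_left[OF bounded_linear_ident, of "f' x"] C x uv by (auto simp: onorm_id)
    qed (use uv in auto)
    then show "cmod (f v - f u) \<le> C * (v - u)"
      using uv by simp
  qed
qed

lemma max_domainI:
  assumes "abs_continuous_on S f" and "g \<in> sq_integrable S" and "ae_derivative S f g"
  shows "f \<in> max_domain \<alpha> \<beta>"
  using assms by (auto simp: max_domain_def)

lemma max_domain_sq_integrable:
  assumes "f \<in> max_domain \<alpha> \<beta>"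
  shows "f \<in> sq_integrable S"
  using assms by (intro sq_integrable_continuous compact_S abs_continuous_on_S_imp_continuous_on)
    (simp add: max_domain_def)

lemma min_domain_iff: "f \<in> min_domain \<alpha> \<beta> \<longleftrightarrow> f \<in> max_domain \<alpha> \<beta> \<and> (\<forall>j. f (lend j) = 0 \<and> f (rend j) = 0)"
  by (auto simp: min_domain_def forall_2 lend_def rend_def)

lemma ae_derivative_add:
  assumes "ae_derivative S f g" and "ae_derivative S f' g'"
  shows "ae_derivative S (\<lambda>x. f x + f' x) (\<lambda>x. g x + g' x)"
  using assms unfolding ae_derivative_def
  by eventually_elim (rule has_vector_derivative_add)

lemma max_domain_add:
  assumes "f \<in> max_domain \<alpha> \<beta>" and "h \<in> max_domain \<alpha> \<beta>"
  shows "(\<lambda>x. f x + h x) \<in> max_domain \<alpha> \<beta>"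
proof -
  obtain g k where "g \<in> sq_integrable S" "ae_derivative S f g" "k \<in> sq_integrable S" "ae_derivative S h k"
    using assms by (auto simp: max_domain_def)
  then show ?thesis
    using assms by (intro max_domainI[of _ "\<lambda>x. g x + k x"] abs_continuous_on_add sq_integrable_add
        ae_derivative_add) (simp_all add: max_domain_def)
qed

lemma ae_derivative_I:
  assumes "ae_derivative S f g"
  shows "AE x in lebesgue_on (I j). (f has_vector_derivative g x) (at x within I j)"
proof -
  have "AE x in lebesgue_on (I j). (f has_vector_derivative g x) (at x within S)"
    using assms by (simp add: ae_derivative_def AE_S_iff)
  then show ?thesis
    by eventually_elim (rule has_vector_derivative_within_subset[OF _ I_subset])
qed

section \<open>Exponential modes\<close>

definition mid :: "2 \<Rightarrow> real" where "mid j = (lend j + rend j) / 2"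

definition len :: "2 \<Rightarrow> real" where "len j = rend j - lend j"

text \<open>The norm of \<open>exp (-2 \<pi> s (x - mid j))\<close> in \<open>L\<^sup>2\<close> of the \<open>j\<close>-th interval, for \<open>s = 1\<close> and for
  \<open>s = -1\<close>: the two agree because the exponentials are centred at the midpoint.\<close>

definition mode_norm :: "2 \<Rightarrow> real" where
  "mode_norm j = sqrt (sinh (2 * pi * len j) / (2 * pi))"

definition mode :: "real \<Rightarrow> 2 \<Rightarrow> real \<Rightarrow> complex" where
  "mode s j x = of_real (exp (- 2 * pi * s * (x - mid j)) / mode_norm j)"

definition modes :: "real \<Rightarrow> complex ^ 2 \<Rightarrow> real \<Rightarrow> complex" where
  "modes s c x = c $ component x * mode s (component x) x"

lemma len_pos: "len j > 0"
  using lend_less_rend[of j] by (simp add: len_def)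

lemma mode_norm_pos: "mode_norm j > 0"
  using len_pos[of j] by (simp add: mode_norm_def)

lemma mode_norm_square: "(mode_norm j)\<^sup>2 = sinh (2 * pi * len j) / (2 * pi)"
  using len_pos[of j] by (simp add: mode_norm_def)

lemma cnj_mode [simp]: "cnj (mode s j x) = mode s j x"
  by (simp add: mode_def)

lemma mode_inverse: "mode (- s) j x * mode s j x = of_real (1 / (mode_norm j)\<^sup>2)"
  by (simp add: mode_def power2_eq_square flip: of_real_mult exp_add)

lemma mode_has_vector_derivative:
  "(mode s j has_vector_derivative of_real (- 2 * pi * s) * mode s j x) (at x within T)"
proof -
  have "((\<lambda>x. exp (- 2 * pi * s * (x - mid j)) / mode_norm j) has_real_derivative
      (- 2 * pi * s) * (exp (- 2 * pi * s * (x - mid j)) / mode_norm j)) (at x within T)"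
    using mode_norm_pos[of j] by (auto intro!: derivative_eq_intros)
  from has_vector_derivative_of_real[OF this, where 'a = complex] show ?thesis
    by (simp add: mode_def[abs_def])
qed

lemma continuous_on_mode: "continuous_on T (mode s j)"
  using mode_has_vector_derivative has_vector_derivative_continuous
  by (metis continuous_on_eq_continuous_within)

lemma modes_eq: "x \<in> I j \<Longrightarrow> modes s c x = c $ j * mode s j x"
  by (simp add: modes_def component_eq)

lemma modes_has_vector_derivative:
  assumes "x \<in> S"
  shows "(modes s c has_vector_derivative of_real (- 2 * pi * s) * modes s c x) (at x within S)"
proof -
  obtain j where j: "x \<in> I j" using assms by (rule mem_S_cases)
  have "((\<lambda>x. c $ j * mode s j x) has_vector_derivative c $ j * (of_real (- 2 * pi * s) * mode s j x))
      (at x within I j)"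
    by (intro has_vector_derivative_mult_right mode_has_vector_derivative)
  then have "((\<lambda>x. c $ j * mode s j x) has_vector_derivative of_real (- 2 * pi * s) * modes s c x)
      (at x within I j)"
    by (simp add: modes_eq[OF j] mult_ac)
  then show ?thesis
    unfolding at_within_S[OF j]
    using has_vector_derivative_transform[OF j, of "modes s c" "\<lambda>x. c $ j * mode s j x"] modes_eq
    by blast
qed

lemma continuous_on_modes: "continuous_on S (modes s c)"
  using modes_has_vector_derivative has_vector_derivative_continuous
  by (metis continuous_on_eq_continuous_within)

lemma modes_sq_integrable: "modes s c \<in> sq_integrable S"
  by (intro sq_integrable_continuous continuous_on_modes compact_S)

lemma modes_ae_derivative: "ae_derivative S (modes s c) (\<lambda>x. of_real (- 2 * pi * s) * modes s c x)"
  unfolding ae_derivative_def by (rule AE_I2, rule modes_has_vector_derivative) simp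

lemma abs_continuous_on_modes: "abs_continuous_on S (modes s c)"
proof (rule abs_continuous_on_S_if_bounded_derivative)
  show "bounded ((\<lambda>x. of_real (- 2 * pi * s) * modes s c x) ` S)"
    by (intro compact_imp_bounded compact_continuous_image compact_S
        continuous_on_mult_left continuous_on_modes)
qed (rule modes_has_vector_derivative)

lemma modes_max_domain: "modes s c \<in> max_domain \<alpha> \<beta>"
  by (rule max_domainI[OF abs_continuous_on_modes sq_integrable_cmult[OF modes_sq_integrable]
        modes_ae_derivative])

lemma modes_sum_max_domain: "(\<lambda>x. modes s c x + modes r d x) \<in> max_domain \<alpha> \<beta>"
  by (intro max_domain_add modes_max_domain)

lemma modes_add: "modes s (c + d) x = modes s c x + modes s d x"
  by (simp add: modes_def algebra_simps)

lemma modes_scale: "modes s (a *s c) x = a * modes s c x"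
  by (simp add: modes_def)

lemma cnj_modes: "cnj (modes s c x) = modes s (\<chi> j. cnj (c $ j)) x"
  by (simp add: modes_def)

lemma mode_lend: "mode s j (lend j) = of_real (exp (pi * s * len j) / mode_norm j)"
  by (simp add: mode_def mid_def len_def field_simps)

lemma mode_rend: "mode s j (rend j) = of_real (exp (- (pi * s * len j)) / mode_norm j)"
  by (simp add: mode_def mid_def len_def field_simps)

lemma mode_norm_one:
  assumes "s = 1 \<or> s = -1"
  shows "(LINT x|lebesgue_on (I j). mode s j x * mode s j x) = 1"
proof -
  have "((\<lambda>x. mode s j x * mode s j x) has_integral
      (of_real (- 1 / (4 * pi * s)) * (mode s j (rend j) * mode s j (rend j))
        - of_real (- 1 / (4 * pi * s)) * (mode s j (lend j) * mode s j (lend j)))) (I j)"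
  proof (rule fundamental_theorem_of_calculus)
    fix x
    have "((\<lambda>x. of_real (- 1 / (4 * pi * s)) * (mode s j x * mode s j x)) has_vector_derivative
      of_real (- 1 / (4 * pi * s)) * (mode s j x * (of_real (- 2 * pi * s) * mode s j x)
        + (of_real (- 2 * pi * s) * mode s j x) * mode s j x)) (at x within I j)"
      by (intro has_vector_derivative_mult_right has_vector_derivative_mult mode_has_vector_derivative)
    then show "((\<lambda>x. of_real (- 1 / (4 * pi * s)) * (mode s j x * mode s j x)) has_vector_derivative
        mode s j x * mode s j x) (at x within I j)"
      using assms by (auto simp: field_simps)
  qed (use lend_less_rend[of j] in simp)
  moreover have "of_real (- 1 / (4 * pi * s)) * (mode s j (rend j) * mode s j (rend j))
        - of_real (- 1 / (4 * pi * s)) * (mode s j (lend j) * mode s j (lend j)) = 1"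
  proof -
    have "(- 1 / (4 * pi * s)) * (exp (- (pi * s * len j)) / mode_norm j * (exp (- (pi * s * len j)) / mode_norm j))
        - (- 1 / (4 * pi * s)) * (exp (pi * s * len j) / mode_norm j * (exp (pi * s * len j) / mode_norm j))
      = (exp (2 * pi * len j * s) - exp (- (2 * pi * len j * s))) / (4 * pi * s * (mode_norm j)\<^sup>2)"
      using assms mode_norm_pos[of j]
      by (auto simp: field_simps power2_eq_square simp flip: exp_add)
    also have "\<dots> = 2 * sinh (2 * pi * len j) / (4 * pi * (mode_norm j)\<^sup>2)"
      using assms mode_norm_pos[of j] by (auto simp: sinh_field_def field_simps)
    also have "\<dots> = 1"
      using len_pos[of j] by (simp add: mode_norm_square)
    finally show ?thesis
      unfolding mode_lend mode_rend by (simp only: of_real_mult[symmetric] of_real_diff[symmetric] of_real_1)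
  qed
  moreover have "integrable (lebesgue_on (I j)) (\<lambda>x. mode s j x * mode s j x)"
    by (intro absolutely_integrable_imp_integrable absolutely_integrable_continuous_real
        continuous_on_mult continuous_on_mode) simp
  ultimately show ?thesis
    by (simp add: lebesgue_integral_eq_integral integral_unique)
qed

lemma modes_inner:
  assumes "s = 1 \<or> s = -1"
  shows "(LINT x|lebesgue_on S. modes s c x * cnj (modes s d x)) = vec_inner c d"
proof -
  have "(LINT x|lebesgue_on (I j). modes s c x * cnj (modes s d x)) = c $ j * cnj (d $ j)" for j
  proof -
    have "(LINT x|lebesgue_on (I j). modes s c x * cnj (modes s d x))
        = (LINT x|lebesgue_on (I j). (c $ j * cnj (d $ j)) * (mode s j x * mode s j x))"
      by (intro Bochner_Integration.integral_cong) (simp_all add: modes_eq mult_ac)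
    then show ?thesis
      by (simp add: mode_norm_one[OF assms])
  qed
  then show ?thesis
    by (simp add: integral_S[OF sq_integrable_mult_cnj[OF modes_sq_integrable modes_sq_integrable]] vec_inner_def)
qed

text \<open>The diagonals \<open>P\<close> and \<open>Q\<close>: the values of a normalized mode at the end where it is large and at
  the end where it is small. The modes for \<open>s = 1\<close> are large on the left, those for \<open>s = -1\<close> on the
  right.\<close>

definition large_value :: "2 \<Rightarrow> real" where "large_value j = exp (pi * len j) / mode_norm j"
definition small_value :: "2 \<Rightarrow> real" where "small_value j = exp (- (pi * len j)) / mode_norm j"

lemma large_small_diff: "(large_value j)\<^sup>2 - (small_value j)\<^sup>2 = 4 * pi"
proof -
  have "(large_value j)\<^sup>2 - (small_value j)\<^sup>2 = 2 * sinh (2 * pi * len j) / (mode_norm j)\<^sup>2"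
    by (simp add: large_value_def small_value_def sinh_field_def power_divide power2_eq_square
        diff_divide_distrib mult.assoc flip: exp_add)
  then show ?thesis
    using len_pos[of j] by (simp add: mode_norm_square)
qed

lemma left_values_eq: "left_values \<alpha> f = (\<chi> j. f (lend j))"
  by (simp add: left_values_def vec_eq_iff forall_2 lend_def)

lemma right_values_eq: "right_values \<beta> f = (\<chi> j. f (rend j))"
  by (simp add: right_values_def vec_eq_iff forall_2 rend_def)

lemma left_values_modes:
  "left_values \<alpha> (\<lambda>x. modes 1 c x + modes (-1) d x) = mix large_value small_value c d"
proof -
  have "modes s c (lend j) = c $ j * mode s j (lend j)" for s c j
    using lend_less_rend[of j] by (intro modes_eq) simp
  then show ?thesis
    by (simp add: left_values_eq vec_eq_iff mode_lend large_value_def small_value_def mult_ac)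
qed

lemma right_values_modes:
  "right_values \<beta> (\<lambda>x. modes 1 c x + modes (-1) d x) = mix small_value large_value c d"
proof -
  have "modes s c (rend j) = c $ j * mode s j (rend j)" for s c j
    using lend_less_rend[of j] by (intro modes_eq) simp
  then show ?thesis
    by (simp add: right_values_eq vec_eq_iff mode_rend large_value_def small_value_def mult_ac)
qed

section \<open>The deficiency spaces\<close>

text \<open>Integration by parts against an exponential; the boundary terms vanish.\<close>

lemma integral_deriv_mult_modes:
  assumes f: "f \<in> min_domain \<alpha> \<beta>" and g: "g \<in> sq_integrable S" and fg: "ae_derivative S f g"
  shows "(LINT x|lebesgue_on S. g x * cnj (modes s c x))
    = of_real (2 * pi * s) * (LINT x|lebesgue_on S. f x * cnj (modes s c x))"
proof -
  define e where "e = modes s (\<chi> j. cnj (c $ j))"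
  define H where "H x = f x * e x" for x
  define H' where "H' x = f x * (of_real (- 2 * pi * s) * e x) + g x * e x" for x
  have "f \<in> max_domain \<alpha> \<beta>"
    using f by (simp add: min_domain_iff)
  then have fS: "f \<in> sq_integrable S" and acf: "abs_continuous_on S f"
    by (simp_all add: max_domain_sq_integrable) (simp add: max_domain_def)
  have int: "integrable (lebesgue_on S) (\<lambda>x. f x * e x)" "integrable (lebesgue_on S) (\<lambda>x. g x * e x)"
    using sq_integrable_mult_cnj[OF fS modes_sq_integrable[of s c]]
      sq_integrable_mult_cnj[OF g modes_sq_integrable[of s c]] by (simp_all add: e_def cnj_modes)
  moreover have H'_eq: "H' = (\<lambda>x. of_real (- 2 * pi * s) * (f x * e x) + g x * e x)"
    by (simp add: H'_def fun_eq_iff mult_ac)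
  ultimately have intH': "integrable (lebesgue_on S) H'"
    unfolding H'_eq by (intro Bochner_Integration.integrable_add integrable_mult_right)
  have bounded: "bounded (f ` S)" "bounded (e ` S)"
    using abs_continuous_on_S_imp_continuous_on[OF acf] continuous_on_modes[of s]
    by (auto simp: e_def intro!: compact_imp_bounded compact_continuous_image compact_S)
  have acH: "abs_continuous_on S H"
    unfolding H_def using bounded
    by (intro abs_continuous_on_mult acf) (simp_all add: e_def abs_continuous_on_modes)
  have derivH: "ae_derivative S H H'"
    using fg modes_ae_derivative[of s "\<chi> j. cnj (c $ j)"] unfolding ae_derivative_def H_def H'_def e_def
    by eventually_elim (rule has_vector_derivative_mult)
  have "(LINT x|lebesgue_on (I j). H' x) = 0" for j
  proof -
    have "(H' has_integral (H (rend j) - H (lend j))) (I j)"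
      using lend_less_rend[of j]
      by (intro abs_continuous_on_has_integral abs_continuous_on_subset[OF acH I_subset]
          ae_derivative_I derivH) simp
    moreover have "H (rend j) = 0" "H (lend j) = 0"
      using f by (simp_all add: H_def min_domain_iff)
    ultimately show ?thesis
      using integrable_I[OF intH', of j] by (simp add: lebesgue_integral_eq_integral integral_unique)
  qed
  then have "(LINT x|lebesgue_on S. H' x) = 0"
    by (simp add: integral_S[OF intH'])
  moreover have "(LINT x|lebesgue_on S. H' x) = of_real (- 2 * pi * s) * (LINT x|lebesgue_on S. f x * e x)
      + (LINT x|lebesgue_on S. g x * e x)"
    using int unfolding H'_eq by simp
  ultimately show ?thesis
    by (simp add: e_def cnj_modes algebra_simps)
qed

text \<open>Up to a constant factor, \<open>w\<close> below is the conjugate of the quotient of \<open>\<psi>\<close> by the expected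
  solution, so the aim is that \<open>w\<close> is almost everywhere constant. The test function is an exponential
  times the tent function \<open>h\<close> with peak at \<open>t\<close>; the exponential turns the weak equation into
  \<open>\<integral> w h' = 0\<close>, and as \<open>h'\<close> is the indicator of \<open>[lend j, t]\<close> minus its mean \<open>a\<close>, the integral of \<open>w\<close>
  over \<open>[lend j, t]\<close> is proportional to the length. Tents are Lipschitz, so their absolute continuity
  and derivatives are elementary.\<close>

lemma weak_solution_on_component:
  assumes \<psi>: "\<psi> \<in> sq_integrable S"
    and weak: "\<And>f g. f \<in> min_domain \<alpha> \<beta> \<Longrightarrow> g \<in> sq_integrable S \<Longrightarrow> ae_derivative S f g \<Longrightarrow>
      (LINT x|lebesgue_on S. g x * cnj (\<psi> x))
        = of_real (2 * pi * s) * (LINT x|lebesgue_on S. f x * cnj (\<psi> x))"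
  shows "\<exists>c. AE x in lebesgue_on (I j). \<psi> x = c * mode s j x"
proof -
  define e where "e = mode (- s) j"
  define w where "w x = e x * cnj (\<psi> x)" for x
  define m where "m = integral (I j) w / of_real (len j)"
  have e_S: "e \<in> sq_integrable S"
    unfolding e_def by (intro sq_integrable_continuous continuous_on_mode compact_S)
  have w_S: "integrable (lebesgue_on S) w"
    unfolding w_def by (rule sq_integrable_mult_cnj[OF e_S \<psi>])
  then have w: "integrable (lebesgue_on (I j)) w"
    by (rule integrable_I)
  then have w_on: "w integrable_on I j"
    by (simp add: integrable_on_lebesgue_on)
  have "integral {lend j..t} w = of_real (t - lend j) * m" if t: "t \<in> I j" for t
  proof -
    define a where "a = (t - lend j) / len j"
    define h where "h x = min x t - lend j - (x - lend j) * a" for x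
    define k where "k x = (if x \<le> t then 1 else 0) - a" for x :: real
    define F where "F i x = (if i = j then e x * of_real (h x) else 0)" for i x
    define f where "f x = F (component x) x" for x
    define g where "g x = of_real (2 * pi * s) * f x
      + (if component x = j then e x * of_real (k x) else 0)" for x
    have h_end: "h (lend j) = 0" "h (rend j) = 0"
      using t len_pos[of j] by (auto simp: h_def a_def len_def)
    have h_deriv: "(h has_real_derivative k x) (at x)" if "x \<noteq> t" for x
    proof (cases "x < t")
      case True
      have "((\<lambda>x. x - lend j - (x - lend j) * a) has_real_derivative k x) (at x)"
        using True by (auto intro!: derivative_eq_intros simp: k_def)
      then show ?thesis
        by (rule has_field_derivative_transform_within_open[of _ _ _ "{..<t}"])
          (use True in \<open>auto simp: h_def\<close>)
    next
      case False
      then have "t < x" using that by simp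
      have "((\<lambda>x. t - lend j - (x - lend j) * a) has_real_derivative k x) (at x)"
        using \<open>t < x\<close> by (auto intro!: derivative_eq_intros simp: k_def)
      then show ?thesis
        by (rule has_field_derivative_transform_within_open[of _ _ _ "{t<..}"])
          (use \<open>t < x\<close> in \<open>auto simp: h_def\<close>)
    qed
    have ac_h: "abs_continuous_on S (\<lambda>x. complex_of_real (h x))"
    proof (rule abs_continuous_on_lipschitz[of _ _ "1 + \<bar>a\<bar>"])
      fix u v :: real assume "u \<le> v"
      have "\<bar>h v - h u\<bar> = \<bar>(min v t - min u t) - (v - u) * a\<bar>"
        by (simp add: h_def algebra_simps)
      also have "\<dots> \<le> \<bar>min v t - min u t\<bar> + \<bar>(v - u) * a\<bar>"
        by (rule abs_triangle_ineq4)
      also have "\<dots> \<le> (v - u) + (v - u) * \<bar>a\<bar>"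
        using \<open>u \<le> v\<close> by (intro add_mono) (auto simp: abs_mult)
      finally show "cmod (of_real (h v) - of_real (h u)) \<le> (1 + \<bar>a\<bar>) * (v - u)"
        by (simp add: algebra_simps flip: of_real_diff)
    qed
    have ac_e: "abs_continuous_on S e"
    proof (rule abs_continuous_on_S_if_bounded_derivative)
      show "(e has_vector_derivative of_real (2 * pi * s) * e x) (at x within S)" for x
        using mode_has_vector_derivative[of "- s" j x S] by (simp add: e_def)
      show "bounded ((\<lambda>x. of_real (2 * pi * s) * e x) ` S)"
        unfolding e_def
        by (intro compact_imp_bounded compact_continuous_image compact_S
            continuous_on_mult_left continuous_on_mode)
    qed
    have bounded: "bounded (e ` S)" "bounded ((\<lambda>x. complex_of_real (h x)) ` S)"
      using abs_continuous_on_S_imp_continuous_on ac_e ac_h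
      by (blast intro: compact_imp_bounded compact_continuous_image compact_S)+
    have ac_f: "abs_continuous_on S f"
      unfolding f_def
    proof (rule abs_continuous_on_piecewise)
      fix i
      show "abs_continuous_on S (F i)"
      proof (cases "i = j")
        case True
        then have "F i = (\<lambda>x. e x * of_real (h x))" by (simp add: F_def fun_eq_iff)
        then show ?thesis by (simp add: abs_continuous_on_mult ac_e ac_h bounded)
      next
        case False
        then have "F i = (\<lambda>x. 0)" by (simp add: F_def fun_eq_iff)
        then show ?thesis by (auto intro: abs_continuous_on_lipschitz[of _ _ 0])
      qed
    qed
    have f_deriv: "(f has_vector_derivative g x) (at x within S)" if "x \<in> S" "x \<noteq> t" for x
    proof -
      obtain i where i: "x \<in> I i" using \<open>x \<in> S\<close> by (rule mem_S_cases)
      have "(F i has_vector_derivative g x) (at x within I i)"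
      proof (cases "i = j")
        case True
        have "((\<lambda>x. e x * of_real (h x)) has_vector_derivative
            e x * of_real (k x) + of_real (2 * pi * s) * e x * of_real (h x)) (at x within I i)"
        proof (rule has_vector_derivative_mult)
          show "(e has_vector_derivative of_real (2 * pi * s) * e x) (at x within I i)"
            using mode_has_vector_derivative[of "- s" j x "I i"] by (simp add: e_def)
          show "((\<lambda>x. complex_of_real (h x)) has_vector_derivative of_real (k x)) (at x within I i)"
            using h_deriv[OF \<open>x \<noteq> t\<close>]
            by (intro has_vector_derivative_of_real) (rule has_field_derivative_at_within)
        qed
        moreover have "F i = (\<lambda>x. e x * of_real (h x))"
          using True by (simp add: F_def fun_eq_iff)
        moreover have "g x = e x * of_real (k x) + of_real (2 * pi * s) * e x * of_real (h x)"
          using True by (simp add: g_def f_def component_eq[OF i] F_def)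
        ultimately show ?thesis by simp
      next
        case False
        then have "F i = (\<lambda>x. 0)" "g x = 0"
          by (simp_all add: g_def f_def component_eq[OF i] F_def fun_eq_iff)
        then show ?thesis by simp
      qed
      then have "(f has_vector_derivative g x) (at x within I i)"
        by (rule has_vector_derivative_transform[OF i, rotated]) (simp add: f_def component_eq)
      then show ?thesis by (simp add: at_within_S[OF i])
    qed
    have "AE x in lebesgue_on S. x \<noteq> t"
    proof -
      have "AE x in lebesgue. x \<noteq> t"
        by (rule AE_I'[of "{t}"]) (auto simp: null_sets_def)
      then show ?thesis by (subst AE_restrict_space_iff) auto
    qed
    then have fg: "ae_derivative S f g"
      unfolding ae_derivative_def by (rule AE_mp) (auto intro!: AE_I2 f_deriv)
    have f_S: "f \<in> sq_integrable S"
      by (intro sq_integrable_continuous compact_S abs_continuous_on_S_imp_continuous_on ac_f)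
    have K_S: "(\<lambda>x. if component x = j then e x * of_real (k x) else 0) \<in> sq_integrable S"
    proof -
      obtain C where C: "\<And>x. x \<in> S \<Longrightarrow> cmod (e x) \<le> C"
        using bounded(1) by (auto simp: bounded_iff)
      show ?thesis
      proof (rule sq_integrable_bounded[of _ _ "C * (1 + \<bar>a\<bar>)"])
        have "(\<lambda>x. if component x = j then complex_of_real (k x) else 0) \<in> borel_measurable borel"
          unfolding component_def k_def by measurable
        then have "(\<lambda>x. if component x = j then complex_of_real (k x) else 0)
            \<in> borel_measurable (lebesgue_on S)"
          by (intro measurable_restrict_space1 measurable_completion) simp
        moreover have "e \<in> borel_measurable (lebesgue_on S)"
          using e_S by (simp add: sq_integrable_def)
        ultimately have "(\<lambda>x. e x * (if component x = j then complex_of_real (k x) else 0))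
            \<in> borel_measurable (lebesgue_on S)"
          by measurable
        then show "(\<lambda>x. if component x = j then e x * of_real (k x) else 0)
            \<in> borel_measurable (lebesgue_on S)"
          by (simp add: if_distrib cong: if_cong)
        fix x assume x: "x \<in> S"
        have "\<bar>k x\<bar> \<le> 1 + \<bar>a\<bar>"
          using abs_triangle_ineq4[of "if x \<le> t then 1 else 0" a] by (auto simp: k_def split: if_splits)
        then have "cmod (e x) * \<bar>k x\<bar> \<le> C * (1 + \<bar>a\<bar>)"
          using C[OF x] by (intro mult_mono) (auto intro: order_trans[OF norm_ge_zero])
        moreover have "0 \<le> C * (1 + \<bar>a\<bar>)"
          using C[OF x] norm_ge_zero[of "e x"] by (intro mult_nonneg_nonneg) linarith+
        ultimately show "cmod (if component x = j then e x * of_real (k x) else 0) \<le> C * (1 + \<bar>a\<bar>)"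
          by (simp add: norm_mult)
      qed (rule lmeasurable_S)
    qed
    have g_S: "g \<in> sq_integrable S"
      unfolding g_def by (intro sq_integrable_add sq_integrable_cmult f_S K_S)
    have "f \<in> min_domain \<alpha> \<beta>"
      unfolding min_domain_iff
    proof (intro conjI allI)
      show "f \<in> max_domain \<alpha> \<beta>" by (rule max_domainI[OF ac_f g_S fg])
      fix i
      have "component (lend i) = i" "component (rend i) = i"
        using lend_less_rend[of i] by (simp_all add: component_eq)
      then show "f (lend i) = 0" "f (rend i) = 0"
        by (auto simp: f_def F_def h_end)
    qed
    then have eq: "(LINT x|lebesgue_on S. g x * cnj (\<psi> x))
        = of_real (2 * pi * s) * (LINT x|lebesgue_on S. f x * cnj (\<psi> x))"
      by (rule weak[OF _ g_S fg])
    define W where "W x = (if component x = j then e x * of_real (k x) else 0) * cnj (\<psi> x)" for x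
    have W_S: "integrable (lebesgue_on S) W"
      unfolding W_def by (rule sq_integrable_mult_cnj[OF K_S \<psi>])
    have "(LINT x|lebesgue_on S. g x * cnj (\<psi> x))
        = (LINT x|lebesgue_on S. of_real (2 * pi * s) * (f x * cnj (\<psi> x)) + W x)"
      by (intro Bochner_Integration.integral_cong) (simp_all add: g_def W_def algebra_simps)
    also have "\<dots> = of_real (2 * pi * s) * (LINT x|lebesgue_on S. f x * cnj (\<psi> x))
        + (LINT x|lebesgue_on S. W x)"
      using W_S sq_integrable_mult_cnj[OF f_S \<psi>] by simp
    finally have "0 = (LINT x|lebesgue_on S. W x)"
      using eq by simp
    also have "\<dots> = (\<Sum>i\<in>UNIV. LINT x|lebesgue_on (I i). W x)"
      by (rule integral_S[OF W_S])
    also have "\<dots> = (\<Sum>i\<in>UNIV. if i = j then (LINT x|lebesgue_on (I j). W x) else 0)"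
    proof (rule sum.cong)
      fix i
      have "(LINT x|lebesgue_on (I i). W x) = (LINT x|lebesgue_on (I i). 0)" if "i \<noteq> j"
        using that by (intro Bochner_Integration.integral_cong) (simp_all add: W_def component_eq)
      then show "(LINT x|lebesgue_on (I i). W x) = (if i = j then (LINT x|lebesgue_on (I j). W x) else 0)"
        by simp
    qed simp
    also have "\<dots> = (LINT x|lebesgue_on (I j). W x)"
      by simp
    also have "\<dots> = integral (I j) W"
      using integrable_I[OF W_S] by (simp add: lebesgue_integral_eq_integral)
    also have "\<dots> = integral (I j) (\<lambda>x. (if x \<in> {lend j..t} then w x else 0) - of_real a * w x)"
      by (rule Henstock_Kurzweil_Integration.integral_cong)
        (auto simp: W_def component_eq w_def k_def algebra_simps)
    also have "\<dots> = integral (I j) (\<lambda>x. if x \<in> {lend j..t} then w x else 0) - integral (I j) (\<lambda>x. of_real a * w x)"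
    proof (rule Henstock_Kurzweil_Integration.integral_diff)
      have "w integrable_on {lend j..t}"
        using w_on t by (auto intro: integrable_subinterval_real)
      moreover have "{lend j..t} \<inter> I j = {lend j..t}"
        using t by auto
      ultimately show "(\<lambda>x. if x \<in> {lend j..t} then w x else 0) integrable_on I j"
        using integrable_restrict_Int[of "{lend j..t}" w "I j"] by (simp only:)
      show "(\<lambda>x. of_real a * w x) integrable_on I j"
        using w_on by (rule integrable_on_mult_right)
    qed
    also have "integral (I j) (\<lambda>x. if x \<in> {lend j..t} then w x else 0) = integral {lend j..t} w"
    proof -
      have "{lend j..t} \<inter> I j = {lend j..t}"
        using t by auto
      then show ?thesis
        using Henstock_Kurzweil_Integration.integral_restrict_Int[of "I j" "{lend j..t}" w]
        by (simp only:)
    qed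
    also have "integral (I j) (\<lambda>x. of_real a * w x) = of_real a * integral (I j) w"
      by (rule integral_mult_right)
    finally have "integral {lend j..t} w = of_real a * integral (I j) w"
      by simp
    then show ?thesis
      by (simp add: a_def m_def)
  qed
  then have "integral {lend j..t} (\<lambda>x. w x - m) = 0" if "t \<in> I j" for t
  proof -
    have "w integrable_on {lend j..t}"
      using w_on that by (auto intro: integrable_subinterval_real)
    then have "integral {lend j..t} (\<lambda>x. w x - m) = integral {lend j..t} w - integral {lend j..t} (\<lambda>x. m)"
      by (intro Henstock_Kurzweil_Integration.integral_diff) auto
    then show ?thesis
      using that \<open>\<And>t. t \<in> I j \<Longrightarrow> integral {lend j..t} w = of_real (t - lend j) * m\<close>
      by (simp add: scaleR_conv_of_real)
  qed
  then have "AE x in lebesgue_on (I j). w x - m = 0"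
    using w by (intro AE_zero_if_initial_integrals_zero) auto
  then have "AE x in lebesgue_on (I j). \<psi> x = (of_real ((mode_norm j)\<^sup>2) * cnj m) * mode s j x"
  proof eventually_elim
    case (elim x)
    have "mode s j x * w x = (e x * mode s j x) * cnj (\<psi> x)"
      by (simp add: w_def)
    also have "e x * mode s j x = of_real (1 / (mode_norm j)\<^sup>2)"
      by (simp add: e_def mode_inverse)
    finally have "cnj (\<psi> x) = of_real ((mode_norm j)\<^sup>2) * (mode s j x * m)"
      using elim mode_norm_pos[of j] by simp
    then have "cnj (cnj (\<psi> x)) = cnj (of_real ((mode_norm j)\<^sup>2) * (mode s j x * m))"
      by (rule arg_cong)
    then show ?case
      by (simp add: mult_ac)
  qed
  then show ?thesis by blast
qed

text \<open>The factor \<open>1 / (2 \<pi> \<i>)\<close> of the momentum operator and the conjugate of \<open>\<i> s\<close> combine to the real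
  number \<open>2 \<pi> s\<close>.\<close>

lemma mem_deficiency_iff:
  assumes \<psi>: "\<psi> \<in> sq_integrable S"
  shows "l2_class S \<psi> \<in> deficiency_space S (min_momentum \<alpha> \<beta>) (\<i> * of_real s) \<longleftrightarrow>
    (\<forall>f\<in>min_domain \<alpha> \<beta>. \<forall>g\<in>sq_integrable S. ae_derivative S f g \<longrightarrow>
      (LINT x|lebesgue_on S. g x * cnj (\<psi> x))
        = of_real (2 * pi * s) * (LINT x|lebesgue_on S. f x * cnj (\<psi> x)))"
proof -
  have *: "l2_inner S (l2_class S (\<lambda>x. 1 / (\<i> * 2 * of_real pi) * g x)) (l2_class S \<psi>)
        = l2_inner S (l2_class S f) (l2_class S (\<lambda>x. \<i> * of_real s * \<psi> x))
      \<longleftrightarrow> (LINT x|lebesgue_on S. g x * cnj (\<psi> x))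
        = of_real (2 * pi * s) * (LINT x|lebesgue_on S. f x * cnj (\<psi> x))"
    if f: "f \<in> min_domain \<alpha> \<beta>" and g: "g \<in> sq_integrable S" for f g
  proof -
    have f: "f \<in> sq_integrable S"
      using f by (simp add: min_domain_iff max_domain_sq_integrable)
    define A where "A = (LINT x|lebesgue_on S. g x * cnj (\<psi> x))"
    define B where "B = (LINT x|lebesgue_on S. f x * cnj (\<psi> x))"
    have "l2_inner S (l2_class S (\<lambda>x. 1 / (\<i> * 2 * of_real pi) * g x)) (l2_class S \<psi>)
        = 1 / (\<i> * 2 * of_real pi) * A"
      unfolding l2_inner_class[OF sq_integrable_cmult[OF g] \<psi>] A_def
      using integral_mult_right_zero[of "lebesgue_on S" "1 / (\<i> * 2 * of_real pi)" "\<lambda>x. g x * cnj (\<psi> x)"]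
      by (simp only: mult.assoc)
    moreover have "l2_inner S (l2_class S f) (l2_class S (\<lambda>x. \<i> * of_real s * \<psi> x))
        = - \<i> * of_real s * B"
    proof -
      have "(\<lambda>x. f x * cnj (\<i> * of_real s * \<psi> x)) = (\<lambda>x. (- \<i> * of_real s) * (f x * cnj (\<psi> x)))"
        by (simp add: fun_eq_iff mult_ac)
      then show ?thesis
        unfolding l2_inner_class[OF f sq_integrable_cmult[OF \<psi>]] B_def
        using integral_mult_right_zero[of "lebesgue_on S" "- \<i> * of_real s" "\<lambda>x. f x * cnj (\<psi> x)"]
        by (simp only:)
    qed
    moreover have "1 / (\<i> * 2 * of_real pi) * A = - \<i> * of_real s * B \<longleftrightarrow> A = of_real (2 * pi * s) * B"
      by (auto simp: field_simps)
    ultimately show ?thesis by (simp add: A_def B_def)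
  qed
  have "l2_class S \<psi> \<in> deficiency_space S (min_momentum \<alpha> \<beta>) (\<i> * of_real s) \<longleftrightarrow>
    (\<forall>f\<in>min_domain \<alpha> \<beta>. \<forall>g\<in>sq_integrable S. ae_derivative S f g \<longrightarrow>
      l2_inner S (l2_class S (\<lambda>x. 1 / (\<i> * 2 * of_real pi) * g x)) (l2_class S \<psi>)
        = l2_inner S (l2_class S f) (l2_class S (\<lambda>x. \<i> * of_real s * \<psi> x)))"
  proof -
    have ball: "(\<forall>(F, K)\<in>min_momentum \<alpha> \<beta>. Q F K) \<longleftrightarrow>
      (\<forall>f\<in>min_domain \<alpha> \<beta>. \<forall>g\<in>sq_integrable S. ae_derivative S f g \<longrightarrow>
        Q (l2_class S f) (l2_class S (\<lambda>x. 1 / (\<i> * 2 * of_real pi) * g x)))" for Q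
      unfolding min_momentum_def momentum_on_def by fast
    have "l2_class S \<psi> \<in> L2 S" "l2_class S (\<lambda>x. \<i> * of_real s * \<psi> x) \<in> L2 S"
      using \<psi> sq_integrable_cmult[OF \<psi>] by (auto simp: L2_iff)
    then show ?thesis
      unfolding deficiency_space_def op_adjoint_def mem_Collect_eq l2_scale_class[OF \<psi>] prod.case ball
      by blast
  qed
  with * show ?thesis by blast
qed

theorem deficiency_space_eq:
  "deficiency_space S (min_momentum \<alpha> \<beta>) (\<i> * of_real s) = range (\<lambda>c. l2_class S (modes s c))"
proof (intro subset_antisym subsetI)
  fix \<Psi> assume \<Psi>: "\<Psi> \<in> deficiency_space S (min_momentum \<alpha> \<beta>) (\<i> * of_real s)"
  then obtain \<psi> where \<psi>: "\<psi> \<in> sq_integrable S" "\<Psi> = l2_class S \<psi>"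
    by (auto simp: deficiency_space_def L2_iff)
  then have "\<exists>c. AE x in lebesgue_on (I j). \<psi> x = c * mode s j x" for j
    using \<Psi> by (intro weak_solution_on_component) (auto simp: mem_deficiency_iff)
  then obtain c where "\<And>j. AE x in lebesgue_on (I j). \<psi> x = c j * mode s j x"
    by metis
  then have "AE x in lebesgue_on (I j). \<psi> x = modes s (\<chi> j. c j) x" for j
  proof (rule AE_mp)
    show "AE x in lebesgue_on (I j). \<psi> x = c j * mode s j x \<longrightarrow> \<psi> x = modes s (\<chi> j. c j) x"
      by (rule AE_I2) (simp add: modes_eq)
  qed
  then have "AE x in lebesgue_on S. \<psi> x = modes s (\<chi> j. c j) x"
    by (simp add: AE_S_iff)
  then have "\<Psi> = l2_class S (modes s (\<chi> j. c j))"
    using \<psi> by (simp add: l2_class_eq_iff modes_sq_integrable)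
  then show "\<Psi> \<in> range (\<lambda>c. l2_class S (modes s c))" by blast
next
  fix \<Psi> assume "\<Psi> \<in> range (\<lambda>c. l2_class S (modes s c))"
  then show "\<Psi> \<in> deficiency_space S (min_momentum \<alpha> \<beta>) (\<i> * of_real s)"
    using integral_deriv_mult_modes by (auto simp: mem_deficiency_iff modes_sq_integrable)
qed

section \<open>Unitary maps between the deficiency spaces and their extensions\<close>

abbreviation L where "L \<equiv> min_momentum \<alpha> \<beta>"

definition plus_class :: "complex ^ 2 \<Rightarrow> l2_elem" where "plus_class c = l2_class S (modes 1 c)"
definition minus_class :: "complex ^ 2 \<Rightarrow> l2_elem" where "minus_class d = l2_class S (modes (-1) d)"

lemma deficiency_plus_eq: "deficiency_plus S L = range plus_class"
  using deficiency_space_eq[of 1] by (simp add: plus_class_def[abs_def])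

lemma deficiency_minus_eq: "deficiency_minus S L = range minus_class"
  using deficiency_space_eq[of "-1"] by (simp add: minus_class_def[abs_def])

text \<open>By linearity and orthonormality of the modes, \<open>plus_class\<close> and \<open>minus_class\<close> are Hilbert space
  isomorphisms from \<open>\<complex>\<^sup>2\<close> onto the deficiency spaces.\<close>

lemma class_add:
  "l2_add S (plus_class c) (plus_class c') = plus_class (c + c')"
  "l2_add S (minus_class c) (minus_class c') = minus_class (c + c')"
  by (simp_all add: plus_class_def minus_class_def l2_add_class modes_sq_integrable modes_add[abs_def])

lemma class_scale:
  "l2_scale S a (plus_class c) = plus_class (a *s c)"
  "l2_scale S a (minus_class c) = minus_class (a *s c)"
  by (simp_all add: plus_class_def minus_class_def l2_scale_class modes_sq_integrable modes_scale[abs_def])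

lemma class_inner:
  "l2_inner S (plus_class c) (plus_class c') = vec_inner c c'"
  "l2_inner S (minus_class c) (minus_class c') = vec_inner c c'"
  by (simp_all add: plus_class_def minus_class_def l2_inner_class modes_sq_integrable modes_inner)

lemma inj_plus_class: "plus_class c = plus_class c' \<longleftrightarrow> c = c'"
  by (metis class_inner(1) vec_inner_eqI)

lemma inj_minus_class: "minus_class c = minus_class c' \<longleftrightarrow> c = c'"
  by (metis class_inner(2) vec_inner_eqI)

definition map_of_matrix :: "complex ^ 2 ^ 2 \<Rightarrow> l2_elem \<Rightarrow> l2_elem" where
  "map_of_matrix A = restrict (\<lambda>\<Psi>. minus_class (A *v inv plus_class \<Psi>)) (deficiency_plus S L)"

lemma inv_plus_class [simp]: "inv plus_class (plus_class c) = c"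
  by (rule inv_f_f) (simp add: inj_def inj_plus_class)

lemma inv_minus_class [simp]: "inv minus_class (minus_class c) = c"
  by (rule inv_f_f) (simp add: inj_def inj_minus_class)

lemma map_of_matrix_plus_class [simp]: "map_of_matrix A (plus_class c) = minus_class (A *v c)"
  by (simp add: map_of_matrix_def deficiency_plus_eq)

lemma map_of_matrix_mem:
  assumes "unitary_matrix A"
  shows "map_of_matrix A \<in> deficiency_unitaries S L"
proof -
  define V where "V = restrict (\<lambda>\<Phi>. plus_class (conj_transpose A *v inv minus_class \<Phi>)) (deficiency_minus S L)"
  have V: "V (minus_class d) = plus_class (conj_transpose A *v d)" for d
    by (simp add: V_def deficiency_minus_eq)
  show ?thesis
    unfolding deficiency_unitaries_def
  proof (intro CollectI conjI bexI[of _ V])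
    show "map_of_matrix A \<in> deficiency_plus S L \<rightarrow>\<^sub>E deficiency_minus S L"
      by (auto simp: map_of_matrix_def deficiency_minus_eq)
    show "V \<in> deficiency_minus S L \<rightarrow>\<^sub>E deficiency_plus S L"
      by (auto simp: V_def deficiency_plus_eq)
  qed (use assms in \<open>auto simp: deficiency_plus_eq deficiency_minus_eq class_add class_scale class_inner V
      matrix_vector_right_distrib vector_scalar_commute vec_inner_conj_transpose
      matrix_vector_mul_assoc unitary_matrix_def\<close>)
qed

lemma bij_betw_map_of_matrix:
  "bij_betw map_of_matrix {A. unitary_matrix A} (deficiency_unitaries S L)"
  unfolding bij_betw_def
proof (intro conjI inj_onI subset_antisym subsetI)
  fix A B assume "map_of_matrix A = map_of_matrix B"
  then have "minus_class (A *v c) = minus_class (B *v c)" for c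
    by (metis map_of_matrix_plus_class)
  then show "A = B"
    by (simp add: inj_minus_class matrix_eq)
next
  fix U assume "U \<in> map_of_matrix ` {A. unitary_matrix A}"
  then show "U \<in> deficiency_unitaries S L"
    using map_of_matrix_mem by auto
next
  fix U assume U: "U \<in> deficiency_unitaries S L"
  then have UE: "U \<in> deficiency_plus S L \<rightarrow>\<^sub>E deficiency_minus S L"
    and add: "\<And>c c'. U (plus_class (c + c')) = l2_add S (U (plus_class c)) (U (plus_class c'))"
    and scale: "\<And>a c. U (plus_class (a *s c)) = l2_scale S a (U (plus_class c))"
    by (auto simp: deficiency_unitaries_def deficiency_plus_eq simp flip: class_add class_scale)
  from U obtain V where
    adj: "\<forall>\<Psi>\<in>deficiency_plus S L. \<forall>\<Phi>\<in>deficiency_minus S L.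
      l2_inner S (U \<Psi>) \<Phi> = l2_inner S \<Psi> (V \<Phi>)"
    and VU: "\<forall>\<Psi>\<in>deficiency_plus S L. V (U \<Psi>) = \<Psi>"
    unfolding deficiency_unitaries_def mem_Collect_eq by (elim conjE bexE)
  define T where "T c = inv minus_class (U (plus_class c))" for c
  have T: "U (plus_class c) = minus_class (T c)" for c
  proof -
    have "U (plus_class c) \<in> range minus_class"
      using UE by (auto simp: deficiency_plus_eq deficiency_minus_eq)
    then obtain d where "U (plus_class c) = minus_class d"
      by blast
    then show ?thesis by (simp add: T_def)
  qed
  have "T (c + c') = T c + T c'" for c c'
    using add[of c c'] by (simp add: T class_add inj_minus_class)
  moreover have "T (a *s c) = a *s T c" for a c
    using scale[of a c] by (simp add: T class_scale inj_minus_class)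
  ultimately have matrix: "matrix T *v c = T c" for c
    by (rule matrix_of_additive_homogeneous)
  have "norm (T c) = norm c" for c
  proof -
    have "vec_inner (T c) (T c) = l2_inner S (U (plus_class c)) (U (plus_class c))"
      by (simp add: T class_inner)
    also have "\<dots> = l2_inner S (plus_class c) (V (U (plus_class c)))"
      using UE by (intro adj[rule_format]) (auto simp: deficiency_plus_eq)
    also have "\<dots> = vec_inner c c"
      by (simp add: VU deficiency_plus_eq class_inner)
    finally show ?thesis
      unfolding vec_inner_self of_real_eq_iff by simp
  qed
  then have "unitary_matrix (matrix T)"
    by (simp add: unitary_matrix_iff_norm matrix)
  moreover have "map_of_matrix (matrix T) = U"
  proof (rule PiE_ext[OF _ UE])
    show "map_of_matrix (matrix T) \<in> deficiency_plus S L \<rightarrow>\<^sub>E deficiency_minus S L"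
      by (auto simp: map_of_matrix_def deficiency_minus_eq)
    show "map_of_matrix (matrix T) \<Psi> = U \<Psi>" if "\<Psi> \<in> deficiency_plus S L" for \<Psi>
      using that by (auto simp: deficiency_plus_eq matrix T)
  qed
  ultimately show "U \<in> map_of_matrix ` {A. unitary_matrix A}"
    by blast
qed

lemma mix_surj: "\<exists>c d. mix large_value small_value c d = x \<and> mix small_value large_value c d = y"
proof (intro exI)
  let ?p = "\<lambda>j. large_value j / (4 * pi)" and ?q = "\<lambda>j. - small_value j / (4 * pi)"
  show "mix large_value small_value (mix ?p ?q x y) (mix ?q ?p x y) = x
      \<and> mix small_value large_value (mix ?p ?q x y) (mix ?q ?p x y) = y"
    using mix_inverse[where p = large_value and q = small_value, OF large_small_diff, where x = x and y = y and c = "mix ?p ?q x y" and d = "mix ?q ?p x y"] by simp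
qed

lemma left_space_eq: "left_space \<alpha> \<beta> = UNIV"
proof -
  have "x \<in> left_space \<alpha> \<beta>" for x
  proof -
    obtain c d where "mix large_value small_value c d = x" using mix_surj by blast
    then have "x = left_values \<alpha> (\<lambda>x. modes 1 c x + modes (-1) d x)"
      by (simp add: left_values_modes)
    then show ?thesis
      unfolding left_space_def using modes_sum_max_domain by blast
  qed
  then show ?thesis by blast
qed

lemma right_space_eq: "right_space \<alpha> \<beta> = UNIV"
proof -
  have "y \<in> right_space \<alpha> \<beta>" for y
  proof -
    obtain c d where "mix small_value large_value c d = y" using mix_surj by blast
    then have "y = right_values \<beta> (\<lambda>x. modes 1 c x + modes (-1) d x)"
      by (simp add: right_values_modes)
    then show ?thesis
      unfolding right_space_def using modes_sum_max_domain by blast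
  qed
  then show ?thesis by blast
qed

lemma bij_betw_boundary_isometries:
  "bij_betw (\<lambda>A. restrict ((*v) A) (left_space \<alpha> \<beta>)) {A. unitary_matrix A} (boundary_isometries \<alpha> \<beta>)"
proof -
  have eq: "boundary_isometries \<alpha> \<beta> = {B. (\<forall>u v. B (u + v) = B u + B v) \<and>
      (\<forall>c u. B (c *s u) = c *s B u) \<and> (\<forall>u. norm (B u) = norm u)}"
    by (auto simp: boundary_isometries_def left_space_eq right_space_eq)
  show ?thesis
    unfolding eq left_space_eq bij_betw_def
  proof (intro conjI inj_onI subset_antisym subsetI)
    fix A B :: "complex ^ 2 ^ 2"
    assume "restrict ((*v) A) UNIV = restrict ((*v) B) UNIV"
    then show "A = B"
      by (simp add: matrix_eq fun_eq_iff)
  next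
    fix B :: "complex ^ 2 \<Rightarrow> complex ^ 2"
    assume "B \<in> {B. (\<forall>u v. B (u + v) = B u + B v) \<and>
      (\<forall>c u. B (c *s u) = c *s B u) \<and> (\<forall>u. norm (B u) = norm u)}"
    moreover from this have "matrix B *v u = B u" for u
      by (intro matrix_of_additive_homogeneous) auto
    ultimately show "B \<in> (\<lambda>A. restrict ((*v) A) UNIV) ` {A. unitary_matrix A}"
      by (intro image_eqI[of _ _ "matrix B"]) (auto simp: unitary_matrix_iff_norm)
  qed (auto simp: unitary_matrix_iff_norm matrix_vector_right_distrib vector_scalar_commute)
qed

text \<open>Both sides consist of the momentum operator acting on sums \<open>f\<^sub>0 + modes 1 c + modes (-1) d\<close>
  with \<open>f\<^sub>0\<close> vanishing at the endpoints. On the left \<open>d = T c\<close>, on the right the boundary condition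
  holds, and these are the same condition.\<close>

lemma von_neumann_extension_eq_boundary_extension:
  assumes TA: "\<And>c d. mix small_value large_value c d = A *v mix large_value small_value c d \<longleftrightarrow> d = T *v c"
  shows "von_neumann_extension S L (map_of_matrix T) = boundary_extension \<alpha> \<beta> ((*v) A)"
proof -
  define p where "p = 1 / (\<i> * 2 * complex_of_real pi)"
  define mode_sum where "mode_sum c d x = modes 1 c x + modes (-1) d x" for c d x
  define mode_deriv where "mode_deriv c d x = of_real (- 2 * pi * 1) * modes 1 c x
    + of_real (- 2 * pi * (- 1)) * modes (-1) d x" for c d x
  have deriv: "ae_derivative S (mode_sum c d) (mode_deriv c d)" for c d
    unfolding mode_sum_def[abs_def] mode_deriv_def[abs_def]
    by (intro ae_derivative_add modes_ae_derivative)
  have sum_S: "mode_sum c d \<in> sq_integrable S" "mode_deriv c d \<in> sq_integrable S" for c d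
    unfolding mode_sum_def[abs_def] mode_deriv_def[abs_def]
    by (intro sq_integrable_add sq_integrable_cmult modes_sq_integrable)+
  have mode_sum_max: "mode_sum c d \<in> max_domain \<alpha> \<beta>" for c d
    unfolding mode_sum_def[abs_def] by (rule modes_sum_max_domain)
  have left: "left_values \<alpha> (\<lambda>x. f x + mode_sum c d x) = left_values \<alpha> f + mix large_value small_value c d"
    and right: "right_values \<beta> (\<lambda>x. f x + mode_sum c d x) = right_values \<beta> f + mix small_value large_value c d"
    for f c d
    using left_values_modes[of c d] right_values_modes[of c d]
    by (simp_all add: left_values_eq right_values_eq mode_sum_def vec_eq_iff)
  have zero_iff: "f \<in> min_domain \<alpha> \<beta> \<longleftrightarrow> f \<in> max_domain \<alpha> \<beta> \<and> left_values \<alpha> f = 0 \<and> right_values \<beta> f = 0" for f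
    by (auto simp: min_domain_iff left_values_eq right_values_eq vec_eq_iff)
  have pair: "(l2_add S (l2_class S f) (l2_add S (plus_class c) (minus_class d)),
        l2_add S (l2_class S (\<lambda>x. p * g x))
          (l2_add S (l2_scale S \<i> (plus_class c)) (l2_scale S (- \<i>) (minus_class d))))
      = (l2_class S (\<lambda>x. f x + mode_sum c d x), l2_class S (\<lambda>x. p * (g x + mode_deriv c d x)))"
    if "f \<in> sq_integrable S" "g \<in> sq_integrable S" for f g c d
  proof -
    have "p * (g x + mode_deriv c d x) = p * g x + (\<i> * modes 1 c x + (- \<i>) * modes (-1) d x)" for x
      by (simp add: p_def mode_deriv_def field_simps)
    then show ?thesis
      using that unfolding plus_class_def minus_class_def mode_sum_def
      by (simp only: l2_add_class l2_scale_class sq_integrable_add sq_integrable_cmult modes_sq_integrable)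
  qed
  show ?thesis
  proof (intro subset_antisym subsetI)
    fix z assume "z \<in> von_neumann_extension S L (map_of_matrix T)"
    then obtain f g c where f: "f \<in> min_domain \<alpha> \<beta>" and g: "g \<in> sq_integrable S"
      and fg: "ae_derivative S f g"
      and z: "z = (l2_add S (l2_class S f) (l2_add S (plus_class c) (minus_class (T *v c))),
        l2_add S (l2_class S (\<lambda>x. p * g x))
          (l2_add S (l2_scale S \<i> (plus_class c)) (l2_scale S (- \<i>) (minus_class (T *v c)))))"
      unfolding von_neumann_extension_def min_momentum_def momentum_on_def p_def
        deficiency_plus_eq[unfolded min_momentum_def momentum_on_def]
      by auto
    define d where "d = T *v c"
    have f_max: "f \<in> max_domain \<alpha> \<beta>" and bv: "left_values \<alpha> f = 0" "right_values \<beta> f = 0"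
      using f by (simp_all add: zero_iff)
    have "z = (l2_class S (\<lambda>x. f x + mode_sum c d x), l2_class S (\<lambda>x. p * (g x + mode_deriv c d x)))"
      unfolding z d_def[symmetric] by (rule pair[OF max_domain_sq_integrable[OF f_max] g])
    moreover have "(\<lambda>x. f x + mode_sum c d x) \<in> max_domain \<alpha> \<beta>"
      by (rule max_domain_add[OF f_max mode_sum_max])
    moreover have "A *v left_values \<alpha> (\<lambda>x. f x + mode_sum c d x)
        = right_values \<beta> (\<lambda>x. f x + mode_sum c d x)"
      using TA[of c d] by (simp add: left right bv d_def)
    moreover have "ae_derivative S (\<lambda>x. f x + mode_sum c d x) (\<lambda>x. g x + mode_deriv c d x)"
      by (intro ae_derivative_add fg deriv)
    moreover have "(\<lambda>x. g x + mode_deriv c d x) \<in> sq_integrable S"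
      by (intro sq_integrable_add g sum_S)
    ultimately show "z \<in> boundary_extension \<alpha> \<beta> ((*v) A)"
      unfolding boundary_extension_def momentum_on_def p_def[symmetric]
      by (intro CollectI exI[of _ "\<lambda>x. f x + mode_sum c d x"] exI[of _ "\<lambda>x. g x + mode_deriv c d x"] conjI)
  next
    fix z assume "z \<in> boundary_extension \<alpha> \<beta> ((*v) A)"
    then obtain f g where f: "f \<in> max_domain \<alpha> \<beta>" and bv: "A *v left_values \<alpha> f = right_values \<beta> f"
      and g: "g \<in> sq_integrable S" and fg: "ae_derivative S f g"
      and z: "z = (l2_class S f, l2_class S (\<lambda>x. p * g x))"
      unfolding boundary_extension_def momentum_on_def p_def by blast
    obtain c d where cd: "mix large_value small_value c d = left_values \<alpha> f" "mix small_value large_value c d = right_values \<beta> f"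
      using mix_surj by blast
    then have d: "d = T *v c"
      using TA[of c d] bv by simp
    \<comment> \<open>Subtracting the modes with the same boundary values as \<open>f\<close>.\<close>
    define f0 where "f0 x = f x + mode_sum (- c) (- d) x" for x
    define g0 where "g0 x = g x + mode_deriv (- c) (- d) x" for x
    have neg: "modes s (- e) x = - modes s e x" for s e x
      by (simp add: modes_def)
    have mix_neg: "mix a b (- c) (- d) = - mix a b c d" for a b
      by (simp add: vec_eq_iff)
    have "f0 \<in> max_domain \<alpha> \<beta>"
      unfolding f0_def[abs_def] by (rule max_domain_add[OF f mode_sum_max])
    then have "f0 \<in> min_domain \<alpha> \<beta>"
      using cd by (simp add: zero_iff f0_def[abs_def] left right mix_neg)
    moreover have g0: "g0 \<in> sq_integrable S"
      unfolding g0_def[abs_def] by (intro sq_integrable_add g sum_S)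
    moreover have "ae_derivative S f0 g0"
      unfolding f0_def[abs_def] g0_def[abs_def] by (intro ae_derivative_add fg deriv)
    ultimately have "(l2_class S f0, l2_class S (\<lambda>x. p * g0 x)) \<in> L"
      unfolding min_momentum_def momentum_on_def p_def by blast
    moreover have "z = (l2_add S (l2_class S f0) (l2_add S (plus_class c) (minus_class d)),
        l2_add S (l2_class S (\<lambda>x. p * g0 x))
          (l2_add S (l2_scale S \<i> (plus_class c)) (l2_scale S (- \<i>) (minus_class d))))"
    proof -
      have "f0 x + mode_sum c d x = f x" "g0 x + mode_deriv c d x = g x" for x
        by (simp_all add: f0_def g0_def mode_sum_def mode_deriv_def neg)
      then show ?thesis
        unfolding pair[OF max_domain_sq_integrable[OF \<open>f0 \<in> max_domain \<alpha> \<beta>\<close>] g0] z by simp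
    qed
    moreover have "plus_class c \<in> deficiency_plus S L" "map_of_matrix T (plus_class c) = minus_class d"
      by (simp_all add: deficiency_plus_eq d)
    ultimately show "z \<in> von_neumann_extension S L (map_of_matrix T)"
      unfolding von_neumann_extension_def
      by (intro CollectI exI[of _ "l2_class S f0"] exI[of _ "l2_class S (\<lambda>x. p * g0 x)"]
          exI[of _ "plus_class c"] conjI) simp_all
  qed
qed

end

theorem proposition2p2:
  fixes \<alpha> \<beta> :: real
  assumes "1 < \<alpha>" and "\<alpha> < \<beta>"
  shows "bij_betw (\<lambda>A. restrict ((*v) A) (left_space \<alpha> \<beta>))
           {A :: complex ^ 2 ^ 2. unitary_matrix A} (boundary_isometries \<alpha> \<beta>) \<and>
         (\<exists>\<Theta>. bij_betw \<Theta> (boundary_isometries \<alpha> \<beta>)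
                 (deficiency_unitaries (two_intervals \<alpha> \<beta>) (min_momentum \<alpha> \<beta>)) \<and>
              (\<forall>B\<in>boundary_isometries \<alpha> \<beta>.
                 von_neumann_extension (two_intervals \<alpha> \<beta>) (min_momentum \<alpha> \<beta>) (\<Theta> B)
                   = boundary_extension \<alpha> \<beta> B))"
proof -
  interpret disjoint_intervals \<alpha> \<beta>
    using assms by unfold_locales
  let ?\<phi> = "\<lambda>A :: complex ^ 2 ^ 2. restrict ((*v) A) (left_space \<alpha> \<beta>)"
  have \<phi>: "bij_betw ?\<phi> {A. unitary_matrix A} (boundary_isometries \<alpha> \<beta>)"
    by (rule bij_betw_boundary_isometries)
  obtain \<tau> where \<tau>: "bij_betw \<tau> {A :: complex ^ 2 ^ 2. unitary_matrix A} {A. unitary_matrix A}"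
    and rel: "\<And>A c d. unitary_matrix A \<Longrightarrow>
      mix small_value large_value c d = A *v mix large_value small_value c d \<longleftrightarrow> d = \<tau> A *v c"
    using unitary_pullback_bij[where p = large_value and q = small_value, OF large_small_diff] by auto
  define \<Theta> where "\<Theta> = map_of_matrix \<circ> \<tau> \<circ> inv_into {A. unitary_matrix A} ?\<phi>"
  have "bij_betw \<Theta> (boundary_isometries \<alpha> \<beta>) (deficiency_unitaries S L)"
    unfolding \<Theta>_def using \<phi> \<tau> bij_betw_map_of_matrix by (blast intro: bij_betw_trans bij_betw_inv_into)
  moreover have "von_neumann_extension S L (\<Theta> B) = boundary_extension \<alpha> \<beta> B"
    if "B \<in> boundary_isometries \<alpha> \<beta>" for B
  proof -
    have "B \<in> ?\<phi> ` {A. unitary_matrix A}"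
      using that unfolding bij_betw_imp_surj_on[OF \<phi>] .
    then obtain A where A: "unitary_matrix A" "B = ?\<phi> A"
      by blast
    then have "\<Theta> B = map_of_matrix (\<tau> A)"
      using bij_betw_inv_into_left[OF \<phi>, of A] by (simp add: \<Theta>_def)
    moreover have "B = (*v) A"
      using A by (simp add: left_space_eq fun_eq_iff)
    ultimately show ?thesis
      using von_neumann_extension_eq_boundary_extension[of A "\<tau> A"] rel[OF A(1)] by simp
  qed
  ultimately show ?thesis
    using \<phi> by blast
qed

end
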